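(* Let $n,t$ be integers with $1\le t\le\frac{n(n-1)}2$ and put $s=\left[\frac{2n+t^2+3t}{t+2}\right]$ (integer part). (1) If $K$ is an algebraically closed field and $t>1$, then every Lie algebra in $\mathfrak N_2^K(n,t)$ contains a commutative subalgebra of dimension $s$. (2) For any infinite field $K$, a generic Lie algebra of $\mathfrak N_2^K(n,t)$ does not have any commutative subalgebra of dimension $s+1$.
   Context: $\mathfrak N_2^K(n,t)$ is the set of all 2-step nilpotent Lie algebras $L$ over $K$ with $\dim L/[L,L]=n$ and $\dim [L,L]=t$. Let $V$ be an $n$-dimensional $K$-vector space, $B_n=B_n(K)$ the space of alternating bilinear forms on $V$, and $S$ a $t$-dimensional vector space with basis $z_1,\dots,z_t$. For a $t$-tuple $\Phi=(\varphi_1,\dots,\varphi_t)\in B_n^t$, $L(\Phi)=V\oplus S$ is the Lie algebra with bracket $[\bar x+\bar{\bar x},\bar y+\bar{\bar y}]=\sum_{i=1}^t\varphi_i(\bar x,\bar y)z_i$ ($\bar x,\bar y\in V$, $\bar{\bar x},\bar{\bar y}\in S$). Let $\mathbb P(B_n^t)$ be the projective space of the vector space $B_n^t$ (the $t$-th direct power), with the Zariski topology, and let $M_{n,t}\subset\mathbb P(B_n^t)$ be the Zariski-open subset of points $(\varphi_1:\dots:\varphi_t)$ with $\varphi_1,\dots,\varphi_t$ linearly independent. To a point of $M_{n,t}$ corresponds the Lie algebra $L(\Phi)\in\mathfrak N_2^K(n,t)$ (well defined up to isomorphism; every algebra of $\mathfrak N_2^K(n,t)$ arises this way up to isomorphism).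 Generic: a generic Lie algebra of $\mathfrak N_2^K(n,t)$ has an (isomorphism-invariant) property $\mathcal A$ if the set of points of $M_{n,t}$ corresponding to algebras without property $\mathcal A$ is contained in some proper Zariski-closed subset of $M_{n,t}$. *)

theory Defs
  imports "HOL-Analysis.Analysis"
begin

section \<open>Two-step nilpotent Lie algebras\<close>

locale lie_algebra = vector_space smul
  for smul :: "'k::field \<Rightarrow> 'l::ab_group_add \<Rightarrow> 'l" +
  fixes bracket :: "'l \<Rightarrow> 'l \<Rightarrow> 'l"
  assumes bracket_linear_left: "Vector_Spaces.linear smul smul (\<lambda>x. bracket x y)"
    and bracket_linear_right: "Vector_Spaces.linear smul smul (\<lambda>y. bracket x y)"
    and bracket_self: "bracket x x = 0"
    and jacobi:
      "bracket x (bracket y z) + bracket y (bracket z x) + bracket z (bracket x y) = 0"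

definition bracket_span ::
    "('k::field \<Rightarrow> 'l::ab_group_add \<Rightarrow> 'l) \<Rightarrow> ('l \<Rightarrow> 'l \<Rightarrow> 'l) \<Rightarrow> 'l set \<Rightarrow> 'l set \<Rightarrow> 'l set" where
  "bracket_span smul bracket A B = module.span smul {bracket x y | x y. x \<in> A \<and> y \<in> B}"

definition derived_algebra ::
    "('k::field \<Rightarrow> 'l::ab_group_add \<Rightarrow> 'l) \<Rightarrow> ('l \<Rightarrow> 'l \<Rightarrow> 'l) \<Rightarrow> 'l set" where
  "derived_algebra smul bracket = bracket_span smul bracket UNIV UNIV"

definition two_step_nilpotent ::
    "('k::field \<Rightarrow> 'l::ab_group_add \<Rightarrow> 'l) \<Rightarrow> ('l \<Rightarrow> 'l \<Rightarrow> 'l) \<Rightarrow> bool" where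
  "two_step_nilpotent smul bracket \<longleftrightarrow>
     derived_algebra smul bracket \<noteq> {0} \<and>
     bracket_span smul bracket (derived_algebra smul bracket) UNIV = {0}"

text \<open>
  \<open>quotient_has_dim smul U n\<close> says that the whole space modulo the subspace \<open>U\<close> has
  dimension \<open>n\<close>: the cosets of the elements of \<open>B\<close> are distinct, linearly independent and
  span the quotient.  A quotient by a variable subspace is not a type, so the library
  \<open>dim\<close> does not apply to it directly.
\<close>

definition quotient_has_dim ::
    "('k::field \<Rightarrow> 'l::ab_group_add \<Rightarrow> 'l) \<Rightarrow> 'l set \<Rightarrow> nat \<Rightarrow> bool" where
  "quotient_has_dim smul U n \<longleftrightarrow>
     (\<exists>B. finite B \<and> card B = n \<and>
        (\<forall>c. (\<Sum>b\<in>B. smul (c b) b) \<in> U \<longrightarrow> (\<forall>b\<in>B. c b = 0)) \<and>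
        (\<forall>x. \<exists>c. x - (\<Sum>b\<in>B. smul (c b) b) \<in> U))"

text \<open>
  The class of two-step nilpotent \<open>L\<close> with \<open>dim L/[L,L] = n\<close> and \<open>dim [L,L] = t\<close>.  The
  library \<open>dim\<close> is 0 on spaces without a finite basis, hence the explicit
  finite-dimensionality of the derived algebra (automatic when \<open>t > 0\<close>).
\<close>

definition nilp2_class ::
    "('k::field \<Rightarrow> 'l::ab_group_add \<Rightarrow> 'l) \<Rightarrow> ('l \<Rightarrow> 'l \<Rightarrow> 'l) \<Rightarrow> nat \<Rightarrow> nat \<Rightarrow> bool" where
  "nilp2_class smul bracket n t \<longleftrightarrow>
     lie_algebra smul bracket \<and>
     two_step_nilpotent smul bracket \<and>
     quotient_has_dim smul (derived_algebra smul bracket) n \<and>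
     (\<exists>B. finite B \<and> module.span smul B = derived_algebra smul bracket) \<and>
     vector_space.dim smul (derived_algebra smul bracket) = t"

definition has_commutative_subalgebra ::
    "('k::field \<Rightarrow> 'l::ab_group_add \<Rightarrow> 'l) \<Rightarrow> ('l \<Rightarrow> 'l \<Rightarrow> 'l) \<Rightarrow> nat \<Rightarrow> bool" where
  "has_commutative_subalgebra smul bracket k \<longleftrightarrow>
     (\<exists>A. module.subspace smul A \<and>
          (\<forall>x\<in>A. \<forall>y\<in>A. bracket x y \<in> A) \<and>
          (\<forall>x\<in>A. \<forall>y\<in>A. bracket x y = 0) \<and>
          vector_space.dim smul A = k)"


section \<open>Tuples of alternating forms and the associated Lie algebras\<close>

text \<open>
  We take \<open>V = K\<^sup>n\<close> and \<open>S = K\<^sup>t\<close>, where \<open>n\<close> and \<open>t\<close> are the cardinalities of the index types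
  \<open>'n\<close> and \<open>'t\<close>; the basis \<open>z\<^sub>i\<close> of \<open>S\<close> is the standard one.
\<close>

type_synonym ('k, 'n, 't) form_tuple = "'t \<Rightarrow> 'k ^ 'n \<Rightarrow> 'k ^ 'n \<Rightarrow> 'k"

definition alternating_form :: "('k::field ^ 'n \<Rightarrow> 'k ^ 'n \<Rightarrow> 'k) \<Rightarrow> bool" where
  "alternating_form \<phi> \<longleftrightarrow>
     (\<forall>y. Vector_Spaces.linear (*s) (*) (\<lambda>x. \<phi> x y)) \<and>
     (\<forall>x. Vector_Spaces.linear (*s) (*) (\<lambda>y. \<phi> x y)) \<and>
     (\<forall>x. \<phi> x x = 0)"

definition form_tuples :: "('k::field, 'n::finite, 't::finite) form_tuple set" where
  "form_tuples = {\<Phi>. \<forall>i. alternating_form (\<Phi> i)}"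

definition lin_indep_tuple :: "('k::field, 'n::finite, 't::finite) form_tuple \<Rightarrow> bool" where
  "lin_indep_tuple \<Phi> \<longleftrightarrow>
     (\<forall>c. (\<forall>x y. (\<Sum>i\<in>UNIV. c i * \<Phi> i x y) = 0) \<longrightarrow> (\<forall>i. c i = 0))"

abbreviation assoc_scale ::
    "'k::field \<Rightarrow> ('k ^ 'n) \<times> ('k ^ 't) \<Rightarrow> ('k ^ 'n) \<times> ('k ^ 't)" where
  "assoc_scale \<equiv> module_prod.scale (*s) (*s)"

definition assoc_bracket ::
    "('k::field, 'n::finite, 't::finite) form_tuple \<Rightarrow>
     ('k ^ 'n) \<times> ('k ^ 't) \<Rightarrow> ('k ^ 'n) \<times> ('k ^ 't) \<Rightarrow> ('k ^ 'n) \<times> ('k ^ 't)" where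
  "assoc_bracket \<Phi> p q = (0, \<Sum>i\<in>UNIV. \<Phi> i (fst p) (fst q) *s axis i 1)"


section \<open>Homogeneous polynomials and the Zariski topology\<close>

text \<open>
  A homogeneous polynomial of degree \<open>d\<close> in variables indexed by the finite type \<open>'i\<close> is given
  by its coefficient function \<open>f\<close> on exponent vectors; only the finitely many exponent vectors
  of total degree \<open>d\<close> are used.
\<close>

definition hom_poly_eval ::
    "nat \<Rightarrow> (('i::finite \<Rightarrow> nat) \<Rightarrow> 'k::field) \<Rightarrow> ('i \<Rightarrow> 'k) \<Rightarrow> 'k" where
  "hom_poly_eval d f x = (\<Sum>m | (\<Sum>i\<in>UNIV. m i) = d. f m * (\<Prod>i\<in>UNIV. x i ^ m i))"

text \<open>
  Gram-matrix coordinates.  They embed the space of tuples linearly into \<open>K\<^sup>t\<^sup>n\<^sup>n\<close>, so every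
  homogeneous polynomial on that space is one in these (redundant) coordinates.
\<close>

definition form_coord ::
    "('k::field, 'n::finite, 't::finite) form_tuple \<Rightarrow> 't \<times> 'n \<times> 'n \<Rightarrow> 'k" where
  "form_coord \<Phi> = (\<lambda>(i, a, b). \<Phi> i (axis a 1) (axis b 1))"

text \<open>
  A projective point is represented by the set of all its representing tuples.
\<close>

definition proj_point ::
    "('k::field, 'n::finite, 't::finite) form_tuple \<Rightarrow> ('k, 'n, 't) form_tuple set" where
  "proj_point \<Phi> = {(\<lambda>i x y. c * \<Phi> i x y) | c. c \<noteq> 0}"

definition proj_space :: "('k::field, 'n::finite, 't::finite) form_tuple set set" where
  "proj_space = proj_point ` (form_tuples - {\<lambda>i x y. 0})"

definition proj_zeros ::
    "(nat \<times> (('t \<times> 'n \<times> 'n \<Rightarrow> nat) \<Rightarrow> 'k)) set \<Rightarrow>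
     ('k::field, 'n::finite, 't::finite) form_tuple set set" where
  "proj_zeros F =
     {p \<in> proj_space. \<forall>(d, f)\<in>F. \<forall>\<Phi>\<in>p. hom_poly_eval d f (form_coord \<Phi>) = 0}"

definition zariski :: "('k::field, 'n::finite, 't::finite) form_tuple set topology" where
  "zariski = topology (\<lambda>U. \<exists>F. U = proj_space - proj_zeros F)"

lemma finite_exponents: "finite {m :: 'i::finite \<Rightarrow> nat. (\<Sum>i\<in>UNIV. m i) = d}"
proof (rule finite_subset)
  show "{m :: 'i \<Rightarrow> nat. (\<Sum>i\<in>UNIV. m i) = d} \<subseteq> PiE UNIV (\<lambda>_. {..d})"
    by (auto intro: member_le_sum)
  show "finite (PiE (UNIV :: 'i set) (\<lambda>_. {..d}))"
    by (intro finite_PiE) auto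
qed

lemma hom_poly_eval_mult:
  fixes f g :: "('i::finite \<Rightarrow> nat) \<Rightarrow> 'k::field"
  obtains h where
    "\<And>x. hom_poly_eval (d + e) h x = hom_poly_eval d f x * hom_poly_eval e g x"
proof
  let ?E = "\<lambda>d. {m :: 'i \<Rightarrow> nat. (\<Sum>i\<in>UNIV. m i) = d}"
  let ?S = "?E d \<times> ?E e"
  let ?add = "\<lambda>(m, m') i. m i + m' i :: nat"
  define h where
    "h m = (\<Sum>(m1, m2) | (m1, m2) \<in> ?S \<and> ?add (m1, m2) = m. f m1 * g m2)" for m
  fix x :: "'i \<Rightarrow> 'k"
  let ?mon = "\<lambda>m :: 'i \<Rightarrow> nat. \<Prod>i\<in>UNIV. x i ^ m i"
  have img: "?add ` ?S \<subseteq> ?E (d + e)"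
    by (auto simp: sum.distrib)
  have fin: "finite ?S"
    by (intro finite_cartesian_product finite_exponents)
  have "hom_poly_eval d f x * hom_poly_eval e g x =
      (\<Sum>q\<in>?S. f (fst q) * g (snd q) * ?mon (?add q))"
    by (simp add: hom_poly_eval_def sum_product sum.cartesian_product case_prod_beta
        power_add prod.distrib mult_ac)
  also have "\<dots> = (\<Sum>m\<in>?E (d + e). \<Sum>q | q \<in> ?S \<and> ?add q = m.
      f (fst q) * g (snd q) * ?mon (?add q))"
    by (rule sum.group[OF fin finite_exponents img, symmetric])
  also have "\<dots> = hom_poly_eval (d + e) h x"
    unfolding hom_poly_eval_def
  proof (rule sum.cong[OF refl])
    fix m
    show "(\<Sum>q | q \<in> ?S \<and> ?add q = m. f (fst q) * g (snd q) * ?mon (?add q)) = h m * ?mon m"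
      unfolding h_def sum_distrib_right by (rule sum.cong) auto
  qed
  finally show
    "hom_poly_eval (d + e) h x = hom_poly_eval d f x * hom_poly_eval e g x" ..
qed

lemma hom_poly_eval_scale:
  "hom_poly_eval d f (\<lambda>i. c * x i) = c ^ d * hom_poly_eval d f x"
  unfolding hom_poly_eval_def sum_distrib_left
  by (rule sum.cong) (auto simp: power_mult_distrib prod.distrib power_sum mult_ac)

lemma form_coord_scale: "form_coord (\<lambda>i x y. c * \<Phi> i x y) = (\<lambda>j. c * form_coord \<Phi> j)"
  by (auto simp: form_coord_def)

lemma proj_point_self: "\<Phi> \<in> proj_point \<Phi>"
  unfolding proj_point_def by (rule CollectI, rule exI[of _ 1]) simp

lemma proj_point_zero_iff:
  "(\<forall>\<Psi>\<in>proj_point \<Phi>. hom_poly_eval d f (form_coord \<Psi>) = 0) \<longleftrightarrow>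
   hom_poly_eval d f (form_coord \<Phi>) = 0"
proof
  assume "\<forall>\<Psi>\<in>proj_point \<Phi>. hom_poly_eval d f (form_coord \<Psi>) = 0"
  then show "hom_poly_eval d f (form_coord \<Phi>) = 0"
    using proj_point_self by blast
qed (auto simp: proj_point_def form_coord_scale hom_poly_eval_scale)

lemma proj_point_in_zeros_iff:
  assumes "proj_point \<Phi> \<in> proj_space"
  shows "proj_point \<Phi> \<in> proj_zeros F \<longleftrightarrow>
    (\<forall>(d, f)\<in>F. hom_poly_eval d f (form_coord \<Phi>) = 0)"
  using assms by (simp add: proj_zeros_def proj_point_zero_iff)

lemma proj_zeros_subset: "proj_zeros F \<subseteq> proj_space"
  by (auto simp: proj_zeros_def)

lemma proj_zeros_Union: "proj_zeros (\<Union>\<F>) = proj_space \<inter> (\<Inter>F\<in>\<F>. proj_zeros F)"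
  unfolding proj_zeros_def by blast

lemma proj_zeros_Un:
  fixes F G :: "(nat \<times> (('t::finite \<times> 'n::finite \<times> 'n \<Rightarrow> nat) \<Rightarrow> 'k::field)) set"
  shows "\<exists>H. (proj_zeros H :: ('k, 'n, 't) form_tuple set set) = proj_zeros F \<union> proj_zeros G"
proof -
  define H where "H = {(d + e, h) | d e f g h. (d, f) \<in> F \<and> (e, g) \<in> G \<and>
    (\<forall>x. hom_poly_eval (d + e) h x = hom_poly_eval d f x * hom_poly_eval e g x)}"
  have "p \<in> proj_zeros H \<longleftrightarrow> p \<in> proj_zeros F \<union> proj_zeros G"
    if p: "p \<in> proj_space" for p :: "('k, 'n, 't) form_tuple set"
  proof -
    from p obtain \<Phi> where \<Phi>: "p = proj_point \<Phi>"
      by (auto simp: proj_space_def)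
    note iff = proj_point_in_zeros_iff[OF p[unfolded \<Phi>], folded \<Phi>]
    show ?thesis
    proof
      assume H0: "p \<in> proj_zeros H"
      show "p \<in> proj_zeros F \<union> proj_zeros G"
      proof (rule ccontr)
        assume "\<not> ?thesis"
        then obtain d f e g where 1: "(d, f) \<in> F" "hom_poly_eval d f (form_coord \<Phi>) \<noteq> 0"
          "(e, g) \<in> G" "hom_poly_eval e g (form_coord \<Phi>) \<noteq> 0"
          by (auto simp: iff)
        obtain h where h:
          "\<And>x. hom_poly_eval (d + e) h x = hom_poly_eval d f x * hom_poly_eval e g x"
          using hom_poly_eval_mult[of d e f g] by blast
        with 1 have "(d + e, h) \<in> H"
          unfolding H_def by blast
        with H0 h 1 show False
          by (auto simp: iff)
      qed
    next
      assume "p \<in> proj_zeros F \<union> proj_zeros G"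
      then show "p \<in> proj_zeros H"
        by (fastforce simp: iff H_def)
    qed
  qed
  then have "proj_zeros H = proj_zeros F \<union> proj_zeros G"
    using proj_zeros_subset by blast
  then show ?thesis by blast
qed

lemma openin_zariski:
  fixes U :: "('k::field, 'n::finite, 't::finite) form_tuple set set"
  shows "openin zariski U \<longleftrightarrow> (\<exists>F. U = proj_space - proj_zeros F)"
proof -
  have "istopology (\<lambda>U :: ('k, 'n, 't) form_tuple set set. \<exists>F. U = proj_space - proj_zeros F)"
    unfolding istopology_def
  proof (intro conjI allI impI)
    fix S T :: "('k, 'n, 't) form_tuple set set"
    assume "\<exists>F. S = proj_space - proj_zeros F" "\<exists>F. T = proj_space - proj_zeros F"
    then obtain F G where *: "S = proj_space - proj_zeros F" "T = proj_space - proj_zeros G"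
      by blast
    obtain H where "(proj_zeros H :: ('k, 'n, 't) form_tuple set set) = proj_zeros F \<union> proj_zeros G"
      using proj_zeros_Un by blast
    then show "\<exists>F. S \<inter> T = proj_space - proj_zeros F"
      using * by blast
  next
    fix \<K> :: "('k, 'n, 't) form_tuple set set set"
    assume "\<forall>K\<in>\<K>. \<exists>F. K = proj_space - proj_zeros F"
    then obtain F where F: "\<And>K. K \<in> \<K> \<Longrightarrow> K = proj_space - proj_zeros (F K)"
      by metis
    have "\<Union>\<K> = (\<Union>K\<in>\<K>. proj_space - proj_zeros (F K))"
      using F by auto
    also have "\<dots> = proj_space - proj_zeros (\<Union>(F ` \<K>))"
      unfolding proj_zeros_Union by blast
    finally show "\<exists>F. \<Union>\<K> = proj_space - proj_zeros F"
      by blast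
  qed
  then show ?thesis
    by (simp add: zariski_def)
qed

lemma topspace_zariski:
  "topspace zariski = (proj_space :: ('k::field, 'n::finite, 't::finite) form_tuple set set)"
proof -
  have *: "hom_poly_eval 0 (\<lambda>_. 1) x = 1" for x :: "'t \<times> 'n \<times> 'n \<Rightarrow> 'k"
  proof -
    have "{m :: 't \<times> 'n \<times> 'n \<Rightarrow> nat. (\<Sum>i\<in>UNIV. m i) = 0} = {\<lambda>_. 0}"
      by auto
    then show ?thesis
      by (simp add: hom_poly_eval_def)
  qed
  have "proj_zeros {(0, \<lambda>_. 1)} = ({} :: ('k, 'n, 't) form_tuple set set)"
    using proj_point_self by (fastforce simp: proj_zeros_def proj_space_def *)
  then have "openin zariski (proj_space :: ('k, 'n, 't) form_tuple set set)"
    unfolding openin_zariski by (intro exI[of _ "{(0, \<lambda>_. 1)}"]) simp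
  then show ?thesis
    by (auto simp: topspace_def openin_zariski)
qed

lemma closedin_zariski: "closedin zariski C \<longleftrightarrow> (\<exists>F. C = proj_zeros F)"
  unfolding closedin_def topspace_zariski openin_zariski
  using proj_zeros_subset by blast


section \<open>Generic properties\<close>

definition param_space :: "('k::field, 'n::finite, 't::finite) form_tuple set set" where
  "param_space = proj_point ` {\<Phi> \<in> form_tuples. lin_indep_tuple \<Phi>}"

text \<open>
  For an isomorphism-invariant property \<open>A\<close>, it does not matter which representative \<open>\<Phi>\<close>
  of the point \<open>p\<close> is used.
\<close>

definition generic ::
    "(('k::field \<Rightarrow> ('k ^ 'n::finite) \<times> ('k ^ 't::finite) \<Rightarrow> ('k ^ 'n) \<times> ('k ^ 't)) \<Rightarrow>
      (('k ^ 'n) \<times> ('k ^ 't) \<Rightarrow> ('k ^ 'n) \<times> ('k ^ 't) \<Rightarrow> ('k ^ 'n) \<times> ('k ^ 't)) \<Rightarrow> bool) \<Rightarrow> bool" where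
  "generic A \<longleftrightarrow>
     (\<exists>Z. closedin (subtopology zariski param_space) Z \<and> Z \<noteq> param_space \<and>
        {p \<in> param_space. \<exists>\<Phi>\<in>p. \<not> A assoc_scale (assoc_bracket \<Phi>)} \<subseteq> Z)"

end

theory Submission
  imports
    Defs
    "HOL-Library.Function_Algebras"
    "HOL-Computational_Algebra.Formal_Laurent_Series"
    "HOL-Computational_Algebra.Polynomial_FPS"
begin

text \<open>
  A subspace of \<open>V\<close> that is isotropic for all \<open>t\<close> forms, together with the derived algebra, spans a
  commutative subalgebra, and conversely. Since \<open>s - t\<close> is the largest \<open>k\<close> with
  \<open>t (k - 1) \<le> 2 (n - k)\<close>, everything reduces to common isotropic subspaces of dimension \<open>k\<close> in the
  two cases \<open>t (k - 1) \<le> 2 (n - k)\<close> and \<open>t (k - 1) > 2 (n - k)\<close>.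

  Part (1). Choose one tuple of forms with a \<open>k\<close>-dimensional isotropic subspace at which the
  linearised isotropy equations are surjective; this is an explicit construction, valid in every
  characteristic for \<open>t \<ge> 2\<close>. On the line from this tuple to the given one, with parameter \<open>X\<close>, the
  subspace can then be deformed coefficient by coefficient to an isotropic subspace over the field
  of Laurent series in \<open>X\<close>. Evaluation at \<open>X = 1\<close> of polynomials extends to a valuation ring of that field
  by Chevalley's theorem, because the ground field is algebraically closed. Reducing a
  normalised basis of the subspace gives an isotropic subspace for the given tuple.

  Part (2). A \<open>k\<close>-dimensional subspace has a basis in reduced form with respect to some set \<open>J\<close> of \<open>k\<close>
  coordinates. The tuples with an isotropic subspace of type \<open>J\<close> are polynomial in fewer parameters
  than there are coordinates on tuples. By counting monomials, a nonzero homogeneous polynomial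
  vanishes on all of them.
\<close>

section \<open>Linear systems\<close>

text \<open>The inequality is a dimension count divided by \<open>k / 2\<close>: the
  \<open>k\<close>-dimensional subspaces of \<open>V\<close> depend on \<open>k * (n - k)\<close>
  parameters, and isotropy for \<open>t\<close> alternating forms imposes
  \<open>t * k * (k - 1) / 2\<close> equations. The count alone gives no solutions: for one
  nondegenerate form on a space of dimension 4 it would allow \<open>k = 3\<close>, while isotropic
  subspaces have dimension at most 2. What must be supplied is one tuple where the equations are
  independent to first order. Its construction rests on two operators on \<open>K^t\<close> with
  invertible commutator; on a line every commutator is zero, so this needs \<open>t \<ge> 2\<close>.
  Their entries are 0, 1 and -1, which keeps the construction valid in every characteristic. The
  deformed subspace is given by power series that need not be polynomials, so \<open>X = 1\<close>
  cannot be substituted into them. The valuation ring plays the part of the completeness of the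
  Grassmannian: after rescaling, a subspace over the large field always has a reduction of the same
  dimension.\<close>

lemma homogeneous_system_nontrivial_solution:
  fixes M :: "'i \<Rightarrow> 'j \<Rightarrow> 'a::field"
  assumes "finite J" "finite I" "card J < card I"
  shows "\<exists>c. (\<exists>i\<in>I. c i \<noteq> 0) \<and> (\<forall>j\<in>J. (\<Sum>i\<in>I. c i * M i j) = 0)"
  using assms
proof (induction J arbitrary: I M rule: finite_induct)
  case empty
  then show ?case
    by (intro exI[of _ "\<lambda>_. 1"]) (auto simp: card_gt_0_iff)
next
  case (insert j0 J)
  show ?case
  proof (cases "\<forall>i\<in>I. M i j0 = 0")
    case True
    have "card J < card I"
      using insert.prems insert.hyps by simp
    from insert.IH[OF insert.prems(1) this] obtain c
      where "\<exists>i\<in>I. c i \<noteq> 0" "\<forall>j\<in>J. (\<Sum>i\<in>I. c i * M i j) = 0"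
      by blast
    with True show ?thesis
      by (intro exI[of _ c]) simp
  next
    case False
    then obtain i0 where i0: "i0 \<in> I" "M i0 j0 \<noteq> 0" by blast
    define I' where "I' = I - {i0}"
    have I': "finite I'" "I = insert i0 I'" "i0 \<notin> I'" "card J < card I'"
      using i0 insert.prems insert.hyps by (auto simp: I'_def)
    obtain c where c: "\<exists>i\<in>I'. c i \<noteq> 0"
      "\<forall>j\<in>J. (\<Sum>i\<in>I'. c i * (M i j - M i j0 / M i0 j0 * M i0 j)) = 0"
      using insert.IH[OF I'(1,4), of "\<lambda>i j. M i j - M i j0 / M i0 j0 * M i0 j"] by blast
    define c' where "c' = c(i0 := - (\<Sum>i\<in>I'. c i * M i j0) / M i0 j0)"
    have eq: "(\<Sum>i\<in>I. c' i * M i j) =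
        - (\<Sum>i\<in>I'. c i * M i j0) / M i0 j0 * M i0 j + (\<Sum>i\<in>I'. c i * M i j)" for j
    proof -
      have "(\<Sum>i\<in>I'. c' i * M i j) = (\<Sum>i\<in>I'. c i * M i j)"
        using I' by (intro sum.cong) (auto simp: c'_def)
      then show ?thesis
        using I' by (simp add: c'_def)
    qed
    have "(\<Sum>i\<in>I. c' i * M i j) = 0" if "j \<in> insert j0 J" for j
    proof (cases "j = j0")
      case True
      then show ?thesis using i0 by (simp add: eq)
    next
      case False
      with that c have "(\<Sum>i\<in>I'. c i * (M i j - M i j0 / M i0 j0 * M i0 j)) = 0" by blast
      then have "(\<Sum>i\<in>I'. c i * M i j) = (\<Sum>i\<in>I'. c i * M i j0) / M i0 j0 * M i0 j"
        by (simp add: algebra_simps sum_subtractf sum_distrib_left sum_distrib_right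
            sum_divide_distrib)
      then show ?thesis by (simp add: eq)
    qed
    moreover have "\<exists>i\<in>I. c' i \<noteq> 0"
      using c(1) I' by (auto simp: c'_def)
    ultimately show ?thesis by blast
  qed
qed

text \<open>Surjectivity from injectivity of the transpose, by induction on the rows. It suffices to
  find a vector \<open>g\<close> that the old rows kill and the new row \<open>i0\<close> does
  not.\<close>

lemma independent_rows_solvable:
  fixes C :: "'i \<Rightarrow> 'j \<Rightarrow> 'a::field"
  assumes "finite I" "finite J"
    and "\<And>y. (\<forall>j\<in>J. (\<Sum>i\<in>I. y i * C i j) = 0) \<Longrightarrow> \<forall>i\<in>I. y i = 0"
  shows "\<exists>h. \<forall>i\<in>I. (\<Sum>j\<in>J. C i j * h j) = b i"
  using assms(1,3)
proof (induction I arbitrary: b rule: finite_induct)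
  case empty
  then show ?case by simp
next
  case (insert i0 I)
  let ?p = "\<lambda>i h. \<Sum>j\<in>J. C i j * h j"
  have indep: "\<forall>i\<in>I. y i = 0" if "\<forall>j\<in>J. (\<Sum>i\<in>I. y i * C i j) = 0" for y
  proof -
    have "(\<Sum>i\<in>I. (y(i0 := 0)) i * C i j) = (\<Sum>i\<in>I. y i * C i j)" for j
      using insert.hyps by (intro sum.cong) auto
    then have "\<forall>i\<in>insert i0 I. (y(i0 := 0)) i = 0"
      using that insert.hyps by (intro insert.prems) simp
    then show ?thesis using insert.hyps by (metis fun_upd_apply insertCI)
  qed
  have solve: "\<exists>h. \<forall>i\<in>I. ?p i h = b i" for b
    using insert.IH indep by blast
  have "\<exists>h. \<forall>i\<in>I. ?p i h = (if i = i' then 1 else 0)" for i'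
    by (rule solve)
  then obtain H where H: "\<And>i' i. i \<in> I \<Longrightarrow> ?p i (H i') = (if i = i' then 1 else 0)"
    by metis
  \<comment> \<open>If row \<open>i0\<close> were a combination of the old rows, its coefficients
    would be \<open>?p i0 (H i)\<close>. This candidate relation must fail in some column
    \<open>j1\<close>.\<close>
  define y where "y = (\<lambda>i. if i = i0 then 1 else - ?p i0 (H i))"
  have "\<not> (\<forall>i\<in>insert i0 I. y i = 0)"
    by (simp add: y_def)
  then obtain j1 where j1: "j1 \<in> J" "(\<Sum>i\<in>insert i0 I. y i * C i j1) \<noteq> 0"
    using insert.prems by blast
  \<comment> \<open>The unit vector at \<open>j1\<close>, corrected by the \<open>H i\<close> so
    that the old rows kill it; row \<open>i0\<close> then returns exactly the defect of the relation
    at \<open>j1\<close>.\<close>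
  define g where "g = (\<lambda>j. (if j = j1 then 1 else 0) - (\<Sum>i\<in>I. C i j1 * H i j))"
  have pg: "?p i g = C i j1 - (\<Sum>i'\<in>I. C i' j1 * ?p i (H i'))" for i
  proof -
    have "?p i g = (\<Sum>j\<in>J. C i j * (if j = j1 then 1 else 0))
        - (\<Sum>j\<in>J. \<Sum>i'\<in>I. C i' j1 * (C i j * H i' j))"
      by (simp add: g_def sum_subtractf right_diff_distrib sum_distrib_left mult_ac)
    also have "(\<Sum>j\<in>J. C i j * (if j = j1 then 1 else 0)) = C i j1"
      using j1(1) assms(2) by (simp add: if_distrib cong: if_cong)
    also have "(\<Sum>j\<in>J. \<Sum>i'\<in>I. C i' j1 * (C i j * H i' j)) = (\<Sum>i'\<in>I. C i' j1 * ?p i (H i'))"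
      by (subst sum.swap) (simp add: sum_distrib_left)
    finally show ?thesis .
  qed
  have g0: "?p i g = 0" if "i \<in> I" for i
    using that insert.hyps by (simp add: pg H if_distrib cong: if_cong)
  have "(\<Sum>i\<in>insert i0 I. y i * C i j1) = C i0 j1 + (\<Sum>i\<in>I. y i * C i j1)"
    using insert.hyps by (simp add: y_def)
  also have "(\<Sum>i\<in>I. y i * C i j1) = (\<Sum>i\<in>I. - (C i j1 * ?p i0 (H i)))"
    using insert.hyps by (intro sum.cong) (auto simp: y_def)
  finally have g1: "?p i0 g \<noteq> 0"
    using j1(2) by (simp add: pg sum_negf)
  obtain h where h: "\<forall>i\<in>I. ?p i h = b i"
    using solve by blast
  define e where "e = (b i0 - ?p i0 h) / ?p i0 g"
  let ?h = "\<lambda>j. h j + e * g j"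
  have "?p i ?h = ?p i h + e * ?p i g" for i
    by (simp add: distrib_left sum.distrib sum_distrib_left mult_ac)
  then have "\<forall>i\<in>insert i0 I. ?p i ?h = b i"
    using h g0 g1 by (simp add: e_def)
  then show ?case by (intro exI[of _ ?h])
qed

section \<open>Structure constants with surjective linearised isotropy equations\<close>

text \<open>Think of \<open>a i j\<close> as the vector of the \<open>(i, j)\<close> entries of \<open>t\<close> alternating matrices.
  The equations \<open>block\<close> express the odd rows and columns by the even ones. Expanding
  \<open>a (2 * b + 1) (2 * c + 1)\<close> and its transpose and cancelling the commutator of \<open>M\<close> and \<open>N\<close> shows that
  the even entries are constant along antidiagonals; next to the diagonal they vanish, because
  \<open>a (2 * b + 1) (2 * b + 1) = 0\<close>. The diagonal equations are used instead of the division by 2 that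
  skew-symmetry alone would require, so that all characteristics are covered. The equations \<open>last\<close>
  deal with the remaining row when \<open>k\<close> is even.\<close>

lemma alternating_grid_zero:
  fixes a :: "nat \<Rightarrow> nat \<Rightarrow> 'v::ab_group_add" and M N :: "'v \<Rightarrow> 'v" and Q :: "'v \<Rightarrow> 'w::ab_group_add"
  assumes M: "\<And>v w. M (v - w) = M v - M w"
    and N: "\<And>v w. N (v - w) = N v - N w"
    and Q: "\<And>v w. Q (v - w) = Q v - Q w"
    and comm: "\<And>v. M (N v) = N (M v) \<Longrightarrow> v = 0"
    and inj: "\<And>v. Q v = 0 \<Longrightarrow> Q (N v) = 0 \<Longrightarrow> v = 0"
    and diag: "\<And>i. i < k \<Longrightarrow> a i i = 0"
    and skew: "\<And>i j. i < k \<Longrightarrow> j < k \<Longrightarrow> a i j = - a j i"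
    and block: "\<And>r b. r < k \<Longrightarrow> 2 * b + 2 < k \<Longrightarrow>
      a r (2 * b + 1) = M (a r (2 * b + 2)) - N (a r (2 * b))"
    and last: "\<And>r b. r < k \<Longrightarrow> 2 * b + 2 = k \<Longrightarrow> Q (a r (2 * b + 1)) + Q (N (a r (2 * b))) = 0"
    and "i < k" "j < k"
  shows "a i j = 0"
proof -
  have zero: "M 0 = 0" "N 0 = 0" "Q 0 = 0"
    using M[of 0 0] N[of 0 0] Q[of 0 0] by simp_all
  have neg: "M (- v) = - M v" "N (- v) = - N v" "Q (- v) = - Q v" for v
    using M[of 0 v] N[of 0 v] Q[of 0 v] zero by simp_all
  have odd_even: "a (2 * b + 1) r = M (a (2 * b + 2) r) - N (a (2 * b) r)"
    if "r < k" "2 * b + 2 < k" for r b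
    using block[OF that] skew[of "2 * b + 1" r] skew[of "2 * b + 2" r] skew[of "2 * b" r] that
    by (simp add: neg)
  have odd_odd: "a (2 * b + 1) (2 * c + 1) =
      M (M (a (2 * b + 2) (2 * c + 2))) - M (N (a (2 * b) (2 * c + 2)))
      - N (M (a (2 * b + 2) (2 * c))) + N (N (a (2 * b) (2 * c)))"
    if "2 * b + 2 < k" "2 * c + 2 < k" for b c
    using block[of "2 * b + 1" c] odd_even[of "2 * c + 2" b] odd_even[of "2 * c" b] that
    by (simp add: M N)
  have antidiag: "a (2 * b + 2) (2 * c) = a (2 * b) (2 * c + 2)"
    if b: "2 * b + 2 < k" and c: "2 * c + 2 < k" for b c
  proof -
    let ?y = "a (2 * b + 2) (2 * c)" and ?z = "a (2 * b) (2 * c + 2)"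
    have "0 = a (2 * b + 1) (2 * c + 1) + a (2 * c + 1) (2 * b + 1)"
      using skew[of "2 * b + 1" "2 * c + 1"] b c by simp
    also have "\<dots> = M (N (?y - ?z)) - N (M (?y - ?z))"
      using odd_odd[OF b c] odd_odd[OF c b] skew[of "2 * c + 2" "2 * b + 2"]
        skew[of "2 * c" "2 * b + 2"] skew[of "2 * c + 2" "2 * b"] skew[of "2 * c" "2 * b"] b c
      by (simp add: M N neg)
    finally have "M (N (?y - ?z)) = N (M (?y - ?z))" by simp
    from comm[OF this] show ?thesis by simp
  qed
  have next_diag: "a (2 * b) (2 * b + 2) = 0" if b: "2 * b + 2 < k" for b
  proof (rule comm)
    show "M (N (a (2 * b) (2 * b + 2))) = N (M (a (2 * b) (2 * b + 2)))"
      using odd_odd[OF b b] diag[of "2 * b + 1"] diag[of "2 * b + 2"] diag[of "2 * b"]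
        skew[of "2 * b + 2" "2 * b"] b
      by (simp add: zero neg)
  qed
  \<comment> \<open>A move along the antidiagonal lowers \<open>d\<close> by 2, so it ends on the
    diagonal (\<open>d = 0\<close>) or next to it (\<open>d = 1\<close>).\<close>
  have even_even_less: "a (2 * c) (2 * (c + d)) = 0" if "2 * (c + d) < k" for c d
    using that
  proof (induction d arbitrary: c rule: less_induct)
    case (less d)
    consider "d = 0" | "d = 1" | d' where "d = d' + 2"
      by (metis One_nat_def add_2_eq_Suc' not0_implies_Suc)
    then show ?case
    proof cases
      case 1
      then show ?thesis using diag less.prems by simp
    next
      case 2
      then show ?thesis using next_diag[of c] less.prems by simp
    next
      case (3 d')
      then have "a (2 * c) (2 * (c + d)) = a (2 * (c + 1)) (2 * (c + 1 + d'))"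
        using antidiag[of c "c + 1 + d'"] less.prems by (simp add: algebra_simps)
      then show ?thesis
        using less.IH[of d' "c + 1"] 3 less.prems by simp
    qed
  qed
  have even_even: "a (2 * b) (2 * c) = 0" if "2 * b < k" "2 * c < k" for b c
  proof (cases "b \<le> c")
    case True
    then show ?thesis using even_even_less[of b "c - b"] that by simp
  next
    case False
    then show ?thesis using even_even_less[of c "b - c"] that skew[of "2 * b" "2 * c"] by simp
  qed
  have even_row: "a (2 * b) r = 0" if "2 * b < k" "r < k" "odd r \<Longrightarrow> r + 1 < k" for b r
  proof (cases "even r")
    case True
    then show ?thesis using even_even that by (auto elim!: evenE)
  next
    case False
    then obtain c where "r = 2 * c + 1" by (auto elim!: oddE)
    then show ?thesis
      using block[of "2 * b" c] even_even[of b "c + 1"] even_even[of b c] that False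
      by (simp add: zero)
  qed
  have all: "a i r = 0" if "i < k" "r < k" "odd i \<Longrightarrow> i + 1 < k" "odd r \<Longrightarrow> r + 1 < k" for i r
  proof (cases "even i")
    case True
    then show ?thesis using even_row that by (auto elim!: evenE)
  next
    case False
    then obtain b where "i = 2 * b + 1" by (auto elim!: oddE)
    then show ?thesis
      using odd_even[of r b] even_row[of "b + 1" r] even_row[of b r] that False by (simp add: zero)
  qed
  show ?thesis
  proof (cases "even k")
    case False
    then show ?thesis
      using all[of i j] \<open>i < k\<close> \<open>j < k\<close> by (metis Suc_eq_plus1 Suc_lessI even_Suc)
  next
    case True
    then obtain q where "k = 2 * q" by (auto elim!: evenE)
    then obtain p where p: "k = 2 * p + 2"
      using \<open>i < k\<close> by (cases q) auto
    \<comment> \<open>For even \<open>k\<close> the last column has no right neighbour, and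
      \<open>last\<close> controls only its image under \<open>Q\<close>. Row
      \<open>2 * p + 1\<close> of \<open>block\<close> links \<open>z (2 * b)\<close>,
      \<open>z (2 * b + 1)\<close> and \<open>z (2 * b + 2)\<close>, so the even entries vanish from
      \<open>b = p\<close> downwards, each time by \<open>inj\<close>.\<close>
    define z where "z r = a r (2 * p + 1)" for r
    have z_skew: "a (2 * p + 1) r = - z r" if "r < k" for r
      using skew[of "2 * p + 1" r] that p by (simp add: z_def)
    have Qz: "Q (z r) = 0" if "r < k - 1" for r
    proof -
      have "a r (2 * p) = 0"
        using all[of r "2 * p"] that p by (cases "even r") (auto elim!: oddE)
      then show ?thesis
        using last[of r p] that p by (simp add: z_def zero)
    qed
    have z_even: "z (2 * b) = 0" if "b \<le> p" for b
      using that
    proof (induction "p - b" arbitrary: b)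
      case 0
      then have "b = p" by simp
      have "Q (N (a (2 * p + 1) (2 * p))) = 0"
        using last[of "2 * p + 1" p] diag[of "2 * p + 1"] p by (simp add: zero)
      then have "Q (N (z (2 * p))) = 0"
        using z_skew[of "2 * p"] p by (simp add: neg)
      then show ?case
        using inj Qz[of "2 * p"] p \<open>b = p\<close> by simp
    next
      case (Suc d)
      have "z (2 * (b + 1)) = 0"
        using Suc.hyps(1)[of "b + 1"] Suc.hyps(2) by simp
      then have "z (2 * b + 1) = - N (z (2 * b))"
        using block[of "2 * p + 1" b] z_skew[of "2 * b + 1"] z_skew[of "2 * b + 2"] z_skew[of "2 * b"]
          Suc.hyps(2) p by (simp add: neg zero)
      then show ?case
        using inj[of "z (2 * b)"] Qz[of "2 * b"] Qz[of "2 * b + 1"] Suc.hyps(2) p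
        by (simp add: neg)
    qed
    have z_odd: "z (2 * b + 1) = 0" if "b < p" for b
      using block[of "2 * p + 1" b] z_skew[of "2 * b + 1"] z_skew[of "2 * b + 2"] z_skew[of "2 * b"]
        z_even[of b] z_even[of "b + 1"] that p by (simp add: neg zero)
    have z: "z r = 0" if "r < k" for r
    proof (cases "r = 2 * p + 1")
      case True
      then show ?thesis using diag[of r] that by (simp add: z_def)
    next
      case False
      then show ?thesis
        using z_even z_odd that p by (cases "even r") (auto elim!: evenE oddE)
    qed
    consider "j = k - 1" | "i = k - 1" | "i < k - 1" "j < k - 1"
      using \<open>i < k\<close> \<open>j < k\<close> by linarith
    then show ?thesis
    proof cases
      case 1
      then show ?thesis using z[of i] \<open>i < k\<close> p by (simp add: z_def)
    next
      case 2
      then show ?thesis using z[of j] z_skew[of j] \<open>j < k\<close> p by simp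
    next
      case 3
      then show ?thesis using all[of i j] p
        by (metis Suc_eq_plus1 Suc_lessI True add_diff_cancel_right' even_Suc less_diff_conv
            less_imp_diff_less)
    qed
  qed
qed


text \<open>Two operators with invertible commutator, preserving the first \<open>t\<close> coordinates, such that a vector
  \<open>v\<close> is determined by the even coordinates of \<open>v\<close> and \<open>N v\<close>. They are block diagonal with
  blocks of size 2, except for one leading block of size 3 when \<open>t\<close> is odd.\<close>

definition shift_M :: "nat \<Rightarrow> (nat \<Rightarrow> 'k::field) \<Rightarrow> nat \<Rightarrow> 'k" where
  "shift_M t v e =
    (if even t then (if odd e then v (e - 1) else 0)
     else if e = 0 then v 1 else if e = 1 then 0 else if e = 2 then - v 0
     else if odd e then v (e + 1) else 0)"

definition shift_N :: "nat \<Rightarrow> (nat \<Rightarrow> 'k::field) \<Rightarrow> nat \<Rightarrow> 'k" where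
  "shift_N t v e =
    (if even t then (if even e then v (e + 1) else 0)
     else if e = 0 then v 1 else if e = 1 then v 2 else if e = 2 then 0
     else if even e then v (e - 1) else 0)"

text \<open>The commutator \<open>M N - N M\<close> is diagonal on the blocks of size 2, with 1 at
  odd and -1 at even coordinates. On the leading block of size 3 it sends
  \<open>(v 0, v 1, v 2)\<close> to \<open>(v 2, v 0, - v 1)\<close>. Both are invertible over every
  field.\<close>

lemma shift_commutator:
  fixes v :: "nat \<Rightarrow> 'k::field"
  assumes "shift_M t (shift_N t v) = shift_N t (shift_M t v)"
  shows "v = 0"
proof
  fix e
  have eq: "shift_M t (shift_N t v) e = shift_N t (shift_M t v) e" for e
    using assms by simp
  show "v e = 0 e"
  proof (cases "even t")
    case True
    then show ?thesis
      using eq[of e] by (cases "even e") (auto simp: shift_M_def shift_N_def)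
  next
    case False
    then show ?thesis
      using eq[of e] eq[of 0] eq[of 1] eq[of 2]
      by (cases "even e"; cases "e = 0"; cases "e = 1"; cases "e = 2")
        (auto simp: shift_M_def shift_N_def split: if_splits)
  qed
qed

text \<open>\<open>shift_N\<close> copies every odd coordinate into an even place: the place before
  it when \<open>t\<close> is even or the coordinate is 1, the place after it otherwise.\<close>

lemma shift_even_coordinates:
  fixes v :: "nat \<Rightarrow> 'k::field"
  assumes "\<And>e. even e \<Longrightarrow> v e = 0" "\<And>e. even e \<Longrightarrow> shift_N t v e = 0"
  shows "v = 0"
proof
  fix e
  show "v e = 0 e"
  proof (cases "even e")
    case False
    then obtain b where "e = 2 * b + 1" by (auto elim!: oddE)
    then show ?thesis
      using assms(2)[of "e - 1"] assms(2)[of "e + 1"]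
      by (auto simp: shift_N_def split: if_splits)
  qed (use assms(1) in simp)
qed

text \<open>Expansion in unit vectors. Cutting off at \<open>t\<close> is harmless because the
  blocks fill \<open>{..<t}\<close> exactly; in particular \<open>e + 1 < t\<close> whenever
  \<open>e + 1\<close> is the partner of \<open>e\<close>.\<close>

lemma shift_coordinate_sum:
  fixes v :: "nat \<Rightarrow> 'k::field"
  assumes "t \<ge> 2" "e < t"
  shows "(\<Sum>l<t. v l * shift_M t (\<lambda>l'. if l' = l then 1 else 0) e) =
      shift_M t (\<lambda>l. if l < t then v l else 0) e"
    and "(\<Sum>l<t. v l * shift_N t (\<lambda>l'. if l' = l then 1 else 0) e) =
      shift_N t (\<lambda>l. if l < t then v l else 0) e"
proof -
  have s: "(\<Sum>l<t. v l * (if j = l then 1 else 0)) = (if j < t then v j else 0)"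
    "(\<Sum>l<t. v l * (if l = j then 1 else 0)) = (if j < t then v j else 0)" for j
    by (auto simp: if_distrib cong: if_cong)
  have "e + 1 < t" if "even e \<longleftrightarrow> even t"
    using that \<open>e < t\<close> by (cases "e + 1 = t") auto
  moreover have "t \<ge> 3" if "odd t"
    using that \<open>t \<ge> 2\<close> by (cases "t = 2") auto
  ultimately show "(\<Sum>l<t. v l * shift_M t (\<lambda>l'. if l' = l then 1 else 0) e) =
      shift_M t (\<lambda>l. if l < t then v l else 0) e"
    and "(\<Sum>l<t. v l * shift_N t (\<lambda>l'. if l' = l then 1 else 0) e) =
      shift_N t (\<lambda>l. if l < t then v l else 0) e"
    using \<open>e < t\<close> unfolding shift_M_def shift_N_def by (cases "e = 0"; auto simp: s sum_negf)+
qed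

lemma shift_outside:
  fixes v :: "nat \<Rightarrow> 'k::field"
  assumes "t \<ge> 2" "\<And>l. l \<ge> t \<Longrightarrow> v l = 0" "e \<ge> t"
  shows "shift_M t v e = 0" "shift_N t v e = 0"
proof -
  have *: "v (e - 1) = 0" if "even e \<longleftrightarrow> odd t"
    using that assms by (cases "e = t") auto
  show "shift_M t v e = 0" "shift_N t v e = 0"
    using * assms by (auto simp: shift_M_def shift_N_def)
qed


text \<open>Here \<open>\<psi> l i c\<close> is the value of form \<open>l\<close> on the
  \<open>i\<close>-th vector of the subspace and the \<open>c\<close>-th complementary vector. The
  linearised isotropy equations send a perturbation \<open>h\<close> to the numbers
  \<open>\<Sum>c. \<psi> l i c * h j c - \<psi> l j c * h i c\<close>. The condition is injectivity
  of the transpose, with the multipliers of the equations written as alternating matrices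
  \<open>a l\<close>.\<close>

definition nondegenerate :: "nat \<Rightarrow> nat \<Rightarrow> nat \<Rightarrow> (nat \<Rightarrow> nat \<Rightarrow> nat \<Rightarrow> 'k::field) \<Rightarrow> bool" where
  "nondegenerate t k w \<psi> \<longleftrightarrow> (\<forall>a.
    (\<forall>l<t. \<forall>i<k. a l i i = 0) \<longrightarrow> (\<forall>l<t. \<forall>i<k. \<forall>j<k. a l i j = - a l j i) \<longrightarrow>
    (\<forall>r<k. \<forall>c<w. (\<Sum>l<t. \<Sum>i<k. a l r i * \<psi> l i c) = 0) \<longrightarrow>
    (\<forall>l<t. \<forall>i<k. \<forall>j<k. a l i j = 0))"

text \<open>The bound on \<open>w\<close> is the number of columns that the construction uses:
  \<open>(k - 1) / 2\<close> blocks of \<open>t\<close> columns for odd \<open>k\<close>; for even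
  \<open>k\<close>, \<open>(k - 2) / 2\<close> such blocks and a last one for the even coordinates
  only, of size \<open>t / 2\<close> rounded up.\<close>

lemma nondegenerate_exists:
  assumes t: "t \<ge> 2" and w: "t * (k - 1) \<le> 2 * w"
  shows "\<exists>\<psi> :: nat \<Rightarrow> nat \<Rightarrow> nat \<Rightarrow> 'k::field. nondegenerate t k w \<psi>"
proof -
  define \<delta> where "\<delta> = (\<lambda>(l :: nat) l'. if l' = l then 1 else 0 :: 'k)"
  \<comment> \<open>The values are read off backwards: column \<open>c = b * t + e\<close> has to
    yield coordinate \<open>e\<close> of the equation \<open>block\<close> of
    \<open>alternating_grid_zero\<close>, and in the last block coordinate \<open>2 * e\<close> of
    the equation \<open>last\<close>.\<close>
  define \<psi> where "\<psi> l i c = (let b = c div t; e = c mod t in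
      if 2 * b + 2 < k then
        (if i = 2 * b + 1 then \<delta> l e else 0) - (if i = 2 * b + 2 then shift_M t (\<delta> l) e else 0)
        + (if i = 2 * b then shift_N t (\<delta> l) e else 0)
      else (if i = 2 * b + 1 then \<delta> l (2 * e) else 0)
        + (if i = 2 * b then shift_N t (\<delta> l) (2 * e) else 0))" for l i c
  have "a l i j = 0"
    if diag: "\<forall>l<t. \<forall>i<k. a l i i = 0" and skew: "\<forall>l<t. \<forall>i<k. \<forall>j<k. a l i j = - a l j i"
      and eq: "\<forall>r<k. \<forall>c<w. (\<Sum>l<t. \<Sum>i<k. a l r i * \<psi> l i c) = 0"
      and l: "l < t" and i: "i < k" and j: "j < k"
    for a :: "nat \<Rightarrow> nat \<Rightarrow> nat \<Rightarrow> 'k" and l i j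
  proof -
    define A where "A r i = (\<lambda>l. if l < t then a l r i else 0)" for r i
    define Q where "Q v = (\<lambda>e. if even e then v e else 0)" for v :: "nat \<Rightarrow> 'k"
    have A0: "A r i l = 0" if "l \<ge> t" for r i l
      using that by (simp add: A_def)
    have col: "(\<Sum>l<t. \<Sum>i<k. a l r i * (if i = j then f l else 0)) = (\<Sum>l<t. a l r j * f l)"
      if "j < k" for r j f
      using that by (simp add: if_distrib cong: if_cong)
    have sum_M: "(\<Sum>l<t. a l r i * shift_M t (\<delta> l) e) = shift_M t (A r i) e"
      and sum_N: "(\<Sum>l<t. a l r i * shift_N t (\<delta> l) e) = shift_N t (A r i) e"
      and sum_\<delta>: "(\<Sum>l<t. a l r i * \<delta> l e) = A r i e" if "e < t" for r i e
      using that shift_coordinate_sum[OF t that, of "\<lambda>l. a l r i"]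
      by (simp_all add: \<delta>_def A_def if_distrib cong: if_cong)
    have block: "A r (2 * b + 1) = shift_M t (A r (2 * b + 2)) - shift_N t (A r (2 * b))"
      if r: "r < k" and b: "2 * b + 2 < k" for r b
    proof
      fix e
      show "A r (2 * b + 1) e = (shift_M t (A r (2 * b + 2)) - shift_N t (A r (2 * b))) e"
      proof (cases "e < t")
        case True
        have "b * t + e < (b + 1) * t"
          using True by simp
        moreover have "t * (2 * b + 2) \<le> t * (k - 1)"
          using b by (intro mult_le_mono2) simp
        ultimately have c: "b * t + e < w"
          using w by (simp add: algebra_simps)
        have d: "(b * t + e) div t = b" "(b * t + e) mod t = e"
          using True by auto
        have "(\<Sum>l<t. \<Sum>i<k. a l r i * \<psi> l i (b * t + e)) =
            (\<Sum>l<t. \<Sum>i<k. a l r i * (if i = 2 * b + 1 then \<delta> l e else 0))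
            - (\<Sum>l<t. \<Sum>i<k. a l r i * (if i = 2 * b + 2 then shift_M t (\<delta> l) e else 0))
            + (\<Sum>l<t. \<Sum>i<k. a l r i * (if i = 2 * b then shift_N t (\<delta> l) e else 0))"
          unfolding \<psi>_def Let_def d if_P[OF b]
          by (simp only: distrib_left right_diff_distrib sum.distrib sum_subtractf)
        also have "\<dots> = A r (2 * b + 1) e - shift_M t (A r (2 * b + 2)) e + shift_N t (A r (2 * b)) e"
          using b by (simp only: col sum_M[OF True] sum_N[OF True] sum_\<delta>[OF True])
        finally show ?thesis
          using eq r c by (simp add: algebra_simps)
      next
        case False
        then show ?thesis
          using shift_outside[OF t A0] by (simp add: A0)
      qed
    qed
    have last: "Q (A r (2 * b + 1)) + Q (shift_N t (A r (2 * b))) = 0"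
      if r: "r < k" and b: "2 * b + 2 = k" for r b
    proof
      fix e
      show "(Q (A r (2 * b + 1)) + Q (shift_N t (A r (2 * b)))) e = 0 e"
      proof (cases "even e \<and> e < t")
        case True
        then obtain e' where e': "e = 2 * e'" by auto
        have "2 * (b * t + e') < t * (2 * b + 1)"
          using True e' by (simp add: algebra_simps)
        also have "\<dots> \<le> 2 * w"
          using w b by auto
        finally have c: "b * t + e' < w" by simp
        have d: "(b * t + e') div t = b" "(b * t + e') mod t = e'"
          using True e' by auto
        have "(\<Sum>l<t. \<Sum>i<k. a l r i * \<psi> l i (b * t + e')) =
            (\<Sum>l<t. \<Sum>i<k. a l r i * (if i = 2 * b + 1 then \<delta> l e else 0))
            + (\<Sum>l<t. \<Sum>i<k. a l r i * (if i = 2 * b then shift_N t (\<delta> l) e else 0))"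
          unfolding \<psi>_def Let_def d e' using b
          by (simp only: distrib_left sum.distrib less_irrefl if_False)
        also have "\<dots> = A r (2 * b + 1) e + shift_N t (A r (2 * b)) e"
          using b True by (simp only: col sum_N sum_\<delta>)
        finally show ?thesis
          using eq r c True by (simp add: Q_def)
      next
        case False
        then show ?thesis
          using shift_outside(2)[OF t A0] by (auto simp: Q_def A0)
      qed
    qed
    have "A i j = 0"
    proof (rule alternating_grid_zero[where M = "shift_M t" and N = "shift_N t" and Q = Q and k = k])
      show "v = 0" if "shift_M t (shift_N t v) = shift_N t (shift_M t v)" for v :: "nat \<Rightarrow> 'k"
        using that by (rule shift_commutator)
      show "v = 0" if "Q v = 0" "Q (shift_N t v) = 0" for v
        using that by (intro shift_even_coordinates[of v t]) (metis Q_def zero_fun_apply)+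
      show "A i i = 0" if "i < k" for i
        using that diag unfolding A_def fun_eq_iff by simp
      show "A i j = - A j i" if "i < k" "j < k" for i j
      proof
        fix l
        show "A i j l = (- A j i) l"
        proof (cases "l < t")
          case True
          then have "a l i j = - a l j i" using skew that by blast
          with True show ?thesis by (simp add: A_def)
        qed (simp add: A_def)
      qed
      show "shift_M t (v - w) = shift_M t v - shift_M t w" for v w :: "nat \<Rightarrow> 'k"
        by (auto simp: fun_eq_iff shift_M_def)
      show "shift_N t (v - w) = shift_N t v - shift_N t w" for v w :: "nat \<Rightarrow> 'k"
        by (auto simp: fun_eq_iff shift_N_def)
      show "Q (v - w) = Q v - Q w" for v w
        by (auto simp: fun_eq_iff Q_def)
    qed (fact block last i j)+
    then have "A i j l = 0" by simp
    then show ?thesis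
      using l by (simp add: A_def)
  qed
  then show ?thesis
    unfolding nondegenerate_def by (intro exI[of _ \<psi>] allI impI)
qed

text \<open>Isotropy of the perturbed subspace, with all terms of higher order moved to the right: the
  coefficient of \<open>fps_X ^ m\<close> on the right involves only the coefficients of \<open>u\<close> below \<open>m\<close>, and the linear
  operator on the left is surjective, being dual to the injective one in \<open>nondegenerate\<close>.\<close>

lemma formal_deformation:
  fixes \<psi> :: "nat \<Rightarrow> nat \<Rightarrow> nat \<Rightarrow> 'k::field" and \<theta> :: "nat \<Rightarrow> nat \<Rightarrow> nat \<Rightarrow> 'k"
  assumes nondeg: "nondegenerate t k w \<psi>"
  shows "\<exists>u :: nat \<Rightarrow> nat \<Rightarrow> 'k fps. (\<forall>i<k. \<forall>x<k. u i x = (if x = i then 1 else 0)) \<and>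
    (\<forall>l<t. \<forall>i<k. \<forall>j<k. i < j \<longrightarrow>
      (\<Sum>c<w. fps_const (\<psi> l i c) * u j (k + c) - fps_const (\<psi> l j c) * u i (k + c)) =
      - fps_X * (\<Sum>x<n. \<Sum>y<n. fps_const (\<theta> l x y) * (u i x * u j y)))"
proof -
  \<comment> \<open>Coefficient of \<open>fps_X ^ p\<close> in coordinate \<open>x\<close> of the
    \<open>i\<close>-th vector: a unit vector in the first \<open>k\<close> coordinates, the
    unknowns \<open>h\<close> in the others. Setting the unknowns to 0 at order 0 makes the
    deformation start at the coordinate subspace.\<close>
  define U where "U h i x p = (if x < k then (if p = 0 \<and> x = i then 1 else 0) else h p (i, x - k))"
    for h :: "nat \<Rightarrow> nat \<times> nat \<Rightarrow> 'k" and i x and p :: nat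
  define T where "T h l i j m = (\<Sum>x<n. \<Sum>y<n. \<theta> l x y * (\<Sum>p=0..m. U h i x p * U h j y (m - p)))"
    for h l i j m
  define P where "P h m r \<longleftrightarrow> (if m = 0 then r = (\<lambda>_. 0)
      else \<forall>l<t. \<forall>i<k. \<forall>j<k. i < j \<longrightarrow>
        (\<Sum>c<w. \<psi> l i c * r (j, c) - \<psi> l j c * r (i, c)) = - T h l i j (m - 1))"
    for h and m :: nat and r
  have solvable: "\<exists>r. P h m r" for h m
  proof (cases "m = 0")
    case False
    define I where "I = {q \<in> {..<t} \<times> {..<k} \<times> {..<k}. fst (snd q) < snd (snd q)}"
    define C where "C q z = (case (q, z) of ((l, i, j), (r, c)) \<Rightarrow>
        (if r = j then \<psi> l i c else 0) - (if r = i then \<psi> l j c else 0))" for q z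
    have "\<exists>g. \<forall>q\<in>I. (\<Sum>z\<in>{..<k} \<times> {..<w}. C q z * g z)
        = (case q of (l, i, j) \<Rightarrow> - T h l i j (m - 1))"
    proof (rule independent_rows_solvable)
      fix y assume y: "\<forall>z\<in>{..<k} \<times> {..<w}. (\<Sum>q\<in>I. y q * C q z) = 0"
      \<comment> \<open>A relation \<open>y\<close> between the equations lives on pairs with
        \<open>i < j\<close>; its alternating extension is what \<open>nondegenerate\<close> speaks
        about.\<close>
      define a where "a l p q = (if p < q then y (l, p, q) else if q < p then - y (l, q, p) else 0)"
        for l p q
      have "(\<Sum>l<t. \<Sum>i<k. a l r i * \<psi> l i c) = 0" if r: "r < k" and c: "c < w" for r c
      proof -
        have eq: "(\<Sum>i<k. \<Sum>j<k. if i < j then y (l, i, j) * C (l, i, j) (r, c) else 0) =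
            - (\<Sum>i<k. a l r i * \<psi> l i c)" for l
        proof -
          have "(\<Sum>i<k. \<Sum>j<k. if i < j then y (l, i, j) * C (l, i, j) (r, c) else 0) =
              (\<Sum>i<k. \<Sum>j<k. (if j = r then if i < r then y (l, i, r) * \<psi> l i c else 0 else 0)
                - (if i = r then if r < j then y (l, r, j) * \<psi> l j c else 0 else 0))"
            by (intro sum.cong refl) (auto simp: C_def)
          also have "\<dots> = (\<Sum>i<k. \<Sum>j<k. if j = r then if i < r then y (l, i, r) * \<psi> l i c else 0 else 0)
              - (\<Sum>j<k. \<Sum>i<k. if i = r then if r < j then y (l, r, j) * \<psi> l j c else 0 else 0)"
            unfolding sum_subtractf by (subst (2) sum.swap) simp
          also have "\<dots> = (\<Sum>i<k. if i < r then y (l, i, r) * \<psi> l i c else 0)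
              - (\<Sum>j<k. if r < j then y (l, r, j) * \<psi> l j c else 0)"
            using r by simp
          also have "\<dots> = - (\<Sum>i<k. a l r i * \<psi> l i c)"
            unfolding sum_subtractf[symmetric] sum_negf[symmetric]
            by (intro sum.cong) (auto simp: a_def)
          finally show ?thesis .
        qed
        have "0 = (\<Sum>q\<in>I. y q * C q (r, c))"
          using y r c by simp
        also have "\<dots> = (\<Sum>l<t. \<Sum>i<k. \<Sum>j<k. if i < j then y (l, i, j) * C (l, i, j) (r, c) else 0)"
          unfolding I_def by (subst sum.inter_filter) (auto simp: sum.cartesian_product intro!: sum.cong)
        finally show ?thesis
          by (simp add: eq sum_negf)
      qed
      then have "\<forall>r<k. \<forall>c<w. (\<Sum>l<t. \<Sum>i<k. a l r i * \<psi> l i c) = 0"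
        by blast
      moreover have "\<forall>l<t. \<forall>i<k. a l i i = 0" "\<forall>l<t. \<forall>i<k. \<forall>j<k. a l i j = - a l j i"
        by (auto simp: a_def)
      ultimately have a0: "\<forall>l<t. \<forall>i<k. \<forall>j<k. a l i j = 0"
        using nondeg[unfolded nondegenerate_def, THEN spec, of a] by blast
      have "y (l, i, j) = 0" if "(l, i, j) \<in> I" for l i j
        using a0[rule_format, of l i j] that by (simp add: I_def a_def)
      then show "\<forall>q\<in>I. y q = 0"
        by auto
    qed (auto simp: I_def)
    then obtain g where g: "\<forall>q\<in>I. (\<Sum>z\<in>{..<k} \<times> {..<w}. C q z * g z)
        = (case q of (l, i, j) \<Rightarrow> - T h l i j (m - 1))" by blast
    have "(\<Sum>c<w. \<psi> l i c * g (j, c) - \<psi> l j c * g (i, c)) = - T h l i j (m - 1)"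
      if "l < t" "i < k" "j < k" "i < j" for l i j
    proof -
      have "(l, i, j) \<in> I"
        using that by (simp add: I_def)
      with g have "- T h l i j (m - 1) = (\<Sum>r<k. \<Sum>c<w. C (l, i, j) (r, c) * g (r, c))"
        by (auto simp: sum.cartesian_product case_prod_unfold)
      also have "\<dots> = (\<Sum>c<w. \<Sum>r<k. (if r = j then \<psi> l i c * g (j, c) else 0)
          - (if r = i then \<psi> l j c * g (i, c) else 0))"
        by (subst sum.swap) (intro sum.cong refl, auto simp: C_def)
      also have "\<dots> = (\<Sum>c<w. \<psi> l i c * g (j, c) - \<psi> l j c * g (i, c))"
        using that by (simp add: sum_subtractf)
      finally show ?thesis ..
    qed
    with False show ?thesis
      by (auto simp: P_def)
  qed (auto simp: P_def)
  have "\<exists>h. \<forall>m. P h m (h m)"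
  proof (rule dependent_wellorder_choice)
    fix r and h h' :: "nat \<Rightarrow> nat \<times> nat \<Rightarrow> 'k" and m :: nat assume hh: "\<And>y. y < m \<Longrightarrow> h y = h' y"
    have "T h l i j (m - 1) = T h' l i j (m - 1)" if "m > 0" for l i j
      unfolding T_def using hh that by (intro sum.cong arg_cong2[where f = "(*)"]) (auto simp: U_def)
    then show "P h m r = P h' m r"
      by (simp add: P_def)
  qed (rule solvable)
  then obtain h where h: "\<And>m. P h m (h m)" by blast
  define u where "u i x = Abs_fps (U h i x)" for i x
  show ?thesis
  proof (intro exI[of _ u] conjI allI impI)
    show "u i x = (if x = i then 1 else 0)" if "x < k" for i x
      using that by (auto simp: u_def U_def fps_eq_iff)
    fix l i j assume *: "l < t" "i < k" "j < k" "i < j"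
    show "(\<Sum>c<w. fps_const (\<psi> l i c) * u j (k + c) - fps_const (\<psi> l j c) * u i (k + c)) =
        - fps_X * (\<Sum>x<n. \<Sum>y<n. fps_const (\<theta> l x y) * (u i x * u j y))" (is "?L = ?R")
    proof (rule fps_ext)
      fix m
      have L: "fps_nth ?L m = (\<Sum>c<w. \<psi> l i c * h m (j, c) - \<psi> l j c * h m (i, c))"
        by (simp add: fps_sum_nth u_def U_def)
      have R: "fps_nth ?R m = (if m = 0 then 0 else - T h l i j (m - 1))"
        by (simp add: fps_sum_nth u_def T_def) (simp add: fps_mult_nth)
      show "fps_nth ?L m = fps_nth ?R m"
        unfolding L R using h[of m] * by (auto simp: P_def)
    qed
  qed
qed

section \<open>Extension of homomorphisms to valuation rings\<close>

text \<open>Homomorphisms defined on a subring of a field are represented by their graphs, so that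
  extension is inclusion and Zorn's lemma applies directly.\<close>

definition partial_ring_hom :: "('f::field \<times> 'k::field) set \<Rightarrow> bool" where
  "partial_ring_hom G \<longleftrightarrow>
     (1, 1) \<in> G \<and>
     (\<forall>a b a' b'. (a, b) \<in> G \<longrightarrow> (a', b') \<in> G \<longrightarrow> (a - a', b - b') \<in> G \<and> (a * a', b * b') \<in> G) \<and>
     (\<forall>b. (0, b) \<in> G \<longrightarrow> b = 0)"

context
  fixes G :: "('f::field \<times> 'k::field) set"
  assumes G: "partial_ring_hom G"
begin

lemma partial_ring_hom_one: "(1, 1) \<in> G"
  using G by (simp add: partial_ring_hom_def)

lemma partial_ring_hom_diff: "(a, b) \<in> G \<Longrightarrow> (a', b') \<in> G \<Longrightarrow> (a - a', b - b') \<in> G"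
  using G by (simp add: partial_ring_hom_def)

lemma partial_ring_hom_mult: "(a, b) \<in> G \<Longrightarrow> (a', b') \<in> G \<Longrightarrow> (a * a', b * b') \<in> G"
  using G by (simp add: partial_ring_hom_def)

lemma partial_ring_hom_zero: "(0, 0) \<in> G"
  using partial_ring_hom_diff[OF partial_ring_hom_one partial_ring_hom_one] by simp

lemma partial_ring_hom_add: "(a, b) \<in> G \<Longrightarrow> (a', b') \<in> G \<Longrightarrow> (a + a', b + b') \<in> G"
  using partial_ring_hom_diff[of a b "0 - a'" "0 - b'"]
    partial_ring_hom_diff[OF partial_ring_hom_zero, of a' b'] by simp

lemma partial_ring_hom_sum:
  "(\<And>i. i \<in> I \<Longrightarrow> (a i, b i) \<in> G) \<Longrightarrow> (\<Sum>i\<in>I. a i, \<Sum>i\<in>I. b i) \<in> G"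
  by (induction I rule: infinite_finite_induct)
    (auto intro: partial_ring_hom_zero partial_ring_hom_add)

lemma partial_ring_hom_unique: "(a, b) \<in> G \<Longrightarrow> (a, b') \<in> G \<Longrightarrow> b = b'"
  using partial_ring_hom_diff[of a b a b'] G unfolding partial_ring_hom_def
  by (metis diff_self eq_iff_diff_eq_0)

end

text \<open>The ideal is generated by an element of least degree, which is not constant because the
  ideal is proper. Algebraic closedness enters here; it is what allows the homomorphisms below to be
  extended without enlarging their target field.\<close>

lemma common_root_of_poly_ideal:
  fixes I :: "'k::alg_closed_field poly set"
  assumes diff: "\<And>p q. p \<in> I \<Longrightarrow> q \<in> I \<Longrightarrow> p - q \<in> I"
    and mult: "\<And>p q. q \<in> I \<Longrightarrow> p * q \<in> I"
    and "1 \<notin> I"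
  shows "\<exists>c. \<forall>q\<in>I. poly q c = 0"
proof (cases "I \<subseteq> {0}")
  case False
  then obtain g0 where "g0 \<in> I" "g0 \<noteq> 0" by blast
  define d where "d = (LEAST d. \<exists>g\<in>I. g \<noteq> 0 \<and> degree g = d)"
  have "\<exists>d. \<exists>g\<in>I. g \<noteq> 0 \<and> degree g = d"
    using \<open>g0 \<in> I\<close> \<open>g0 \<noteq> 0\<close> by blast
  from LeastI_ex[OF this] obtain g where g: "g \<in> I" "g \<noteq> 0" "degree g = d"
    unfolding d_def by blast
  have least: "d \<le> degree q" if "q \<in> I" "q \<noteq> 0" for q
    unfolding d_def using that by (intro Least_le) blast
  have "degree g \<noteq> 0"
  proof
    assume "degree g = 0"
    then obtain a where a: "g = [:a:]" by (rule degree_eq_zeroE)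
    with g have "[:inverse a:] * g = 1"
      by (simp add: one_pCons)
    with mult[OF g(1), of "[:inverse a:]"] assms(3) show False by simp
  qed
  then obtain c where c: "poly g c = 0"
    using alg_closed_imp_poly_has_root by blast
  have "poly q c = 0" if "q \<in> I" for q
  proof -
    have "q mod g = q - (q div g) * g"
      by (simp add: minus_div_mult_eq_mod)
    then have "q mod g \<in> I"
      using diff mult g that by simp
    moreover have "q mod g = 0 \<or> degree (q mod g) < d"
      using degree_mod_less[of g q] g by auto
    ultimately have "q mod g = 0"
      using least by fastforce
    then have "q = (q div g) * g"
      by (metis add.right_neutral div_mult_mod_eq)
    then show ?thesis
      using c by (metis mult_zero_right poly_mult)
  qed
  then show ?thesis by blast
next
  case True
  then show ?thesis by (intro exI[of _ 0]) auto
qed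

text \<open>The relations that prevent an extension to \<open>x\<close>: the ideal generated in \<open>R[x]\<close> by the
  kernel of the partial homomorphism contains \<open>1\<close>.\<close>

definition obstruction :: "('f::field \<times> 'k::field) set \<Rightarrow> 'f \<Rightarrow> nat \<Rightarrow> (nat \<Rightarrow> 'f) \<Rightarrow> bool" where
  "obstruction G x n a \<longleftrightarrow>
     (\<forall>i. (a i, if i = 0 then 1 else 0) \<in> G) \<and> (\<forall>i>n. a i = 0) \<and> (\<Sum>i\<le>n. a i * x ^ i) = 0"

text \<open>Multiplied by \<open>x ^ n\<close>, the relation \<open>b\<close> becomes one in
  \<open>x\<close> with reversed coefficients \<open>b (n - j)\<close>. Subtracting
  \<open>a n\<close> times it from \<open>b 0\<close> times the relation \<open>a\<close> cancels
  the top term. As \<open>b 0\<close> maps to 1 and \<open>a n\<close> to 0, the new constant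
  coefficient still maps to 1. Cross-multiplying by \<open>b 0\<close> avoids inverting it in a
  domain that need not be local.\<close>

lemma obstruction_reduce:
  assumes G: "partial_ring_hom G" and x: "x \<noteq> 0" and "m \<le> n"
    and a: "obstruction G x n a" and b: "obstruction G (inverse x) m b"
  shows "n > 0 \<and> (\<exists>c. obstruction G x (n - 1) c)"
proof -
  have "n \<noteq> 0"
  proof
    assume "n = 0"
    with a have "a 0 = 0" "(a 0, 1) \<in> G"
      by (auto simp: obstruction_def dest: spec[of _ 0])
    then show False
      using partial_ring_hom_unique[OF G, of 0 1 0] partial_ring_hom_zero[OF G] by simp
  qed
  define c where "c = (\<lambda>j. if j < n then b 0 * a j - a n * b (n - j) else 0)"
  have ga: "(a i, if i = 0 then 1 else 0) \<in> G" and gb: "(b i, if i = 0 then 1 else 0) \<in> G" for i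
    using a b by (auto simp: obstruction_def)
  have "(c j, if j = 0 then 1 else 0) \<in> G" for j
  proof (cases "j < n")
    case True
    have "(b 0 * a j - a n * b (n - j), 1 * (if j = 0 then 1 else 0) - 0 * 0) \<in> G"
      using ga[of j] ga[of n] gb[of 0] gb[of "n - j"] True
      by (intro partial_ring_hom_diff[OF G] partial_ring_hom_mult[OF G]) auto
    then show ?thesis using True by (simp add: c_def)
  next
    case False
    then show ?thesis using \<open>n \<noteq> 0\<close> partial_ring_hom_zero[OF G] by (simp add: c_def)
  qed
  moreover have "(\<Sum>j\<le>n - 1. c j * x ^ j) = 0"
  proof -
    have "(\<Sum>j\<le>n. b (n - j) * x ^ j) = (\<Sum>i\<le>n. b i * x ^ (n - i))"
      by (rule sum.reindex_bij_witness[of _ "\<lambda>i. n - i" "\<lambda>i. n - i"]) auto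
    also have "\<dots> = x ^ n * (\<Sum>i\<le>n. b i * inverse x ^ i)"
      using x unfolding sum_distrib_left
      by (intro sum.cong) (auto simp: power_diff field_simps power_inverse)
    also have "(\<Sum>i\<le>n. b i * inverse x ^ i) = (\<Sum>i\<le>m. b i * inverse x ^ i)"
      using b \<open>m \<le> n\<close> by (intro sum.mono_neutral_right) (auto simp: obstruction_def)
    finally have 1: "(\<Sum>j\<le>n. b (n - j) * x ^ j) = 0"
      using b by (simp add: obstruction_def)
    have "(\<Sum>j\<le>n - 1. c j * x ^ j) = (\<Sum>j\<le>n. (b 0 * a j - a n * b (n - j)) * x ^ j)"
    proof (rule sum.mono_neutral_cong_left)
      have "{..n} - {..n - 1} = {n}" using \<open>n \<noteq> 0\<close> by auto
      then show "\<forall>i\<in>{..n} - {..n - 1}. (b 0 * a i - a n * b (n - i)) * x ^ i = 0"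
        by simp
    qed (use \<open>n \<noteq> 0\<close> in \<open>auto simp: c_def\<close>)
    also have "\<dots> = b 0 * (\<Sum>j\<le>n. a j * x ^ j) - a n * (\<Sum>j\<le>n. b (n - j) * x ^ j)"
      by (simp add: sum_distrib_left sum_subtractf algebra_simps)
    finally show ?thesis
      using 1 a by (simp add: obstruction_def)
  qed
  ultimately have "obstruction G x (n - 1) c"
    using \<open>n \<noteq> 0\<close> by (auto simp: obstruction_def c_def)
  with \<open>n \<noteq> 0\<close> show ?thesis by blast
qed

text \<open>Descent on \<open>n + m\<close>: the longer of the two relations is shortened, with
  \<open>x\<close> and \<open>inverse x\<close> exchanging roles; a relation of length 0 would say
  that 0 maps to 1.\<close>

lemma not_both_obstructed:
  assumes G: "partial_ring_hom G" and x: "x \<noteq> 0"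
    and "obstruction G x n a" "obstruction G (inverse x) m b"
  shows False
  using assms(2-)
proof (induction "n + m" arbitrary: n m x a b rule: less_induct)
  case less
  show False
  proof (cases "m \<le> n")
    case True
    with obstruction_reduce[OF G less.prems(1) True less.prems(2,3)] less show False
      by (metis add_less_cancel_right diff_less zero_less_one)
  next
    case False
    then have "m > 0 \<and> (\<exists>c. obstruction G (inverse x) (m - 1) c)"
      using less.prems by (intro obstruction_reduce[OF G, of _ n m b a]) auto
    then obtain c where "m > 0" "obstruction G (inverse x) (m - 1) c" by blast
    then show False
      using less.hyps[of n "m - 1" x a c] less.prems by simp
  qed
qed

text \<open>In a maximal extension, an element outside the domain must be obstructed, since
  otherwise the homomorphism would extend to it; and \<open>x\<close> and \<open>inverse x\<close>
  are never both obstructed.\<close>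

lemma chevalley_extension:
  fixes G0 :: "('f::field \<times> 'k::alg_closed_field) set"
  assumes G0: "partial_ring_hom G0" and surj: "Range G0 = UNIV"
  obtains G where "G0 \<subseteq> G" "partial_ring_hom G" "\<And>x. x \<in> Domain G \<or> inverse x \<in> Domain G"
proof -
  let ?\<A> = "{G. G0 \<subseteq> G \<and> partial_ring_hom G}"
  have chain: "\<Union>\<C> \<in> ?\<A>" if "\<C> \<noteq> {}" "subset.chain ?\<A> \<C>" for \<C>
  proof -
    have C: "G0 \<subseteq> X" "partial_ring_hom X" if "X \<in> \<C>" for X
      using \<open>subset.chain ?\<A> \<C>\<close> that by (auto simp: subset.chain_def)
    have ub: "\<exists>X\<in>\<C>. p \<in> X \<and> q \<in> X" if "p \<in> \<Union>\<C>" "q \<in> \<Union>\<C>" for p q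
    proof -
      from that obtain X Y where "X \<in> \<C>" "p \<in> X" "Y \<in> \<C>" "q \<in> Y" by blast
      moreover have "X \<subseteq> Y \<or> Y \<subseteq> X"
        using \<open>subset.chain ?\<A> \<C>\<close> \<open>X \<in> \<C>\<close> \<open>Y \<in> \<C>\<close> by (meson subset_chain_def)
      ultimately show ?thesis by blast
    qed
    have "partial_ring_hom (\<Union>\<C>)"
      unfolding partial_ring_hom_def
    proof (intro conjI allI impI)
      show "(1, 1) \<in> \<Union>\<C>"
        using that(1) C partial_ring_hom_one by blast
    next
      fix b assume "(0, b) \<in> \<Union>\<C>"
      then show "b = 0"
        using C(2) by (auto simp: partial_ring_hom_def)
    next
      fix a b a' b' assume "(a, b) \<in> \<Union>\<C>" "(a', b') \<in> \<Union>\<C>"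
      from ub[OF this] obtain X where "X \<in> \<C>" "(a, b) \<in> X" "(a', b') \<in> X" by blast
      then show "(a - a', b - b') \<in> \<Union>\<C>" "(a * a', b * b') \<in> \<Union>\<C>"
        using C(2)[of X] partial_ring_hom_diff partial_ring_hom_mult by blast+
    qed
    moreover have "G0 \<subseteq> \<Union>\<C>"
      using that(1) C(1) by blast
    ultimately show ?thesis by simp
  qed
  have "?\<A> \<noteq> {}" using G0 by blast
  from subset_Zorn_nonempty[OF this chain] obtain G where
    G: "G0 \<subseteq> G" "partial_ring_hom G"
    and max: "\<And>X. G0 \<subseteq> X \<Longrightarrow> partial_ring_hom X \<Longrightarrow> G \<subseteq> X \<Longrightarrow> X = G"
    by auto
  note one = partial_ring_hom_one[OF G(2)] and zero = partial_ring_hom_zero[OF G(2)]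
    and diff = partial_ring_hom_diff[OF G(2)] and mult = partial_ring_hom_mult[OF G(2)]
    and sum = partial_ring_hom_sum[OF G(2)]
  \<comment> \<open>Graph of the coefficientwise map on polynomials; it is onto because of
    \<open>surj\<close>.\<close>
  define P where "P = {(p, q). \<forall>i. (coeff p i, coeff q i) \<in> G}"
  have P_diff: "(p - p', q - q') \<in> P" if "(p, q) \<in> P" "(p', q') \<in> P" for p q p' q'
    using that diff by (simp add: P_def)
  have P_mult: "(p * p', q * q') \<in> P" if "(p, q) \<in> P" "(p', q') \<in> P" for p q p' q'
    using that by (auto simp: P_def coeff_mult intro!: sum mult)
  have P_const: "([:a:], [:b:]) \<in> P" if "(a, b) \<in> G" for a b
    using that zero by (auto simp: P_def coeff_pCons split: nat.split)
  have P_X: "([:0, 1:], [:0, 1:]) \<in> P"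
    using one zero by (auto simp: P_def coeff_pCons split: nat.split)
  have P_surj: "\<exists>p. (p, q) \<in> P" for q
  proof (induction q)
    case 0
    show ?case using P_const[OF zero] by auto
  next
    case (pCons c q)
    obtain a p where ap: "(a, c) \<in> G" "(p, q) \<in> P"
      using surj G(1) pCons.IH by blast
    have "(pCons a p, pCons c q) \<in> P"
      using ap by (auto simp: P_def coeff_pCons split: nat.split)
    then show ?case by blast
  qed
  have ext: "\<exists>n a. obstruction G x n a" if "x \<notin> Domain G" for x
  proof -
    \<comment> \<open>Reductions of the polynomials that vanish at \<open>x\<close>. They form an
      ideal of all of \<open>'k poly\<close>, and a common root \<open>c\<close> is an admissible
      value at \<open>x\<close>; an ideal containing 1 yields the obstruction.\<close>
    define I where "I = {q. \<exists>p. (p, q) \<in> P \<and> poly p x = 0}"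
    have "1 \<in> I"
    proof (rule ccontr)
      assume "1 \<notin> I"
      have "\<exists>c. \<forall>q\<in>I. poly q c = 0"
      proof (rule common_root_of_poly_ideal)
        fix p q assume "p \<in> I" "q \<in> I"
        then show "p - q \<in> I"
          using P_diff by (fastforce simp: I_def)
      next
        fix p q assume "q \<in> I"
        then show "p * q \<in> I"
          using P_mult P_surj[of p] by (fastforce simp: I_def)
      qed fact
      then obtain c where c: "\<And>q. q \<in> I \<Longrightarrow> poly q c = 0" by blast
      define G' where "G' = {(poly p x, poly q c) | p q. (p, q) \<in> P}"
      have "partial_ring_hom G'"
        unfolding partial_ring_hom_def
      proof (intro conjI allI impI)
        show "(1, 1) \<in> G'"
          using P_const[OF one] by (force simp: G'_def)
      next
        fix b assume "(0, b) \<in> G'"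
        then show "b = 0"
          using c by (fastforce simp: G'_def I_def)
      next
        fix a b a' b' assume "(a, b) \<in> G'" "(a', b') \<in> G'"
        then obtain p q p' q' where *: "(p, q) \<in> P" "(p', q') \<in> P"
          "a = poly p x" "b = poly q c" "a' = poly p' x" "b' = poly q' c"
          by (auto simp: G'_def)
        show "(a - a', b - b') \<in> G'"
          unfolding G'_def using P_diff[OF *(1,2)] *(3-)
          by (intro CollectI exI[of _ "p - p'"] exI[of _ "q - q'"]) simp
        show "(a * a', b * b') \<in> G'"
          unfolding G'_def using P_mult[OF *(1,2)] *(3-)
          by (intro CollectI exI[of _ "p * p'"] exI[of _ "q * q'"]) simp
      qed
      moreover have "G \<subseteq> G'"
        using P_const by (force simp: G'_def)
      ultimately have "G' = G"
        using max G(1) by blast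
      moreover have "(x, c) \<in> G'"
        using P_X by (force simp: G'_def)
      ultimately show False using that by blast
    qed
    then obtain p where p: "\<forall>i. (coeff p i, coeff 1 i) \<in> G" "poly p x = 0"
      by (auto simp: I_def P_def)
    have "coeff (1 :: 'k poly) i = (if i = 0 then 1 else 0)" for i
      by (simp add: coeff_1)
    then have "obstruction G x (degree p) (coeff p)"
      using p by (auto simp: obstruction_def poly_altdef coeff_eq_0)
    then show ?thesis by blast
  qed
  have "x \<in> Domain G \<or> inverse x \<in> Domain G" for x
  proof (rule ccontr)
    assume *: "\<not> ?thesis"
    then have "x \<noteq> 0" using zero by auto
    then show False
      using ext[of x] ext[of "inverse x"] * not_both_obstructed[OF G(2)] by blast
  qed
  with G show ?thesis using that by blast
qed

section \<open>Common isotropic subspaces\<close>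

text \<open>Divisibility with respect to the valuation ring \<open>Domain G\<close> is a total
  preorder on nonzero elements, so a finite set has an element that divides all the others.\<close>

lemma valuation_pivot:
  assumes G: "partial_ring_hom G" and val: "\<And>x. x \<in> Domain G \<or> inverse x \<in> Domain G"
    and S: "finite S" "S \<noteq> {}" and nz: "\<And>x. x \<in> S \<Longrightarrow> z x \<noteq> 0"
  shows "\<exists>x0\<in>S. \<forall>x\<in>S. z x / z x0 \<in> Domain G"
  using S nz
proof (induction S rule: finite_ne_induct)
  case (singleton x)
  then show ?case using partial_ring_hom_one[OF G] by auto
next
  case (insert y S)
  then obtain x0 where x0: "x0 \<in> S" "\<forall>x\<in>S. z x / z x0 \<in> Domain G" by auto
  show ?case
  proof (cases "z y / z x0 \<in> Domain G")
    case True
    then show ?thesis using x0 by auto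
  next
    case False
    then have "z x0 / z y \<in> Domain G"
      using val[of "z y / z x0"] by (simp add: inverse_eq_divide)
    then have "z x / z y \<in> Domain G" if xS: "x \<in> S" for x
    proof -
      obtain b b' where "(z x / z x0, b) \<in> G" "(z x0 / z y, b') \<in> G"
        using x0(2)[rule_format, OF xS] \<open>z x0 / z y \<in> Domain G\<close> by (meson DomainE)
      from partial_ring_hom_mult[OF G this] show ?thesis
        using insert.prems x0 by (auto simp: field_simps)
    qed
    moreover have "z y / z y \<in> Domain G"
      using insert.prems partial_ring_hom_one[OF G] by auto
    ultimately show ?thesis by auto
  qed
qed

lemma sum_swap_pairs:
  fixes f :: "'a \<Rightarrow> 'b \<Rightarrow> 'c \<Rightarrow> 'd \<Rightarrow> 'e::comm_monoid_add"
  shows "(\<Sum>x\<in>A. \<Sum>y\<in>B. \<Sum>i\<in>C. \<Sum>j\<in>D. f x y i j) = (\<Sum>i\<in>C. \<Sum>j\<in>D. \<Sum>x\<in>A. \<Sum>y\<in>B. f x y i j)"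
proof -
  have "(\<Sum>x\<in>A. \<Sum>y\<in>B. \<Sum>i\<in>C. \<Sum>j\<in>D. f x y i j) = (\<Sum>x\<in>A. \<Sum>i\<in>C. \<Sum>y\<in>B. \<Sum>j\<in>D. f x y i j)"
    by (intro sum.cong refl sum.swap)
  also have "\<dots> = (\<Sum>i\<in>C. \<Sum>x\<in>A. \<Sum>y\<in>B. \<Sum>j\<in>D. f x y i j)"
    by (rule sum.swap)
  also have "\<dots> = (\<Sum>i\<in>C. \<Sum>x\<in>A. \<Sum>j\<in>D. \<Sum>y\<in>B. f x y i j)"
    by (intro sum.cong refl sum.swap)
  also have "\<dots> = (\<Sum>i\<in>C. \<Sum>j\<in>D. \<Sum>x\<in>A. \<Sum>y\<in>B. f x y i j)"
    by (intro sum.cong refl sum.swap)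
  finally show ?thesis .
qed

text \<open>Gaussian elimination inside the span of the \<open>u i\<close>: each new vector vanishes at the earlier pivots
  \<open>p b\<close> and is scaled by its entry of largest valuation, so it reduces to a vector with a 1 at its
  pivot, and the reductions stay linearly independent.\<close>

lemma specialize_isotropic:
  fixes G :: "('f::field \<times> 'k::field) set" and u :: "nat \<Rightarrow> nat \<Rightarrow> 'f"
  assumes G: "partial_ring_hom G" and val: "\<And>x. x \<in> Domain G \<or> inverse x \<in> Domain G"
    and "k \<le> n" and u: "\<And>i x. i < k \<Longrightarrow> x < k \<Longrightarrow> u i x = (if x = i then 1 else 0)"
    and B: "\<And>l x y. l < t \<Longrightarrow> x < n \<Longrightarrow> y < n \<Longrightarrow> (B l x y, \<phi> l x y) \<in> G"
    and iso: "\<And>l i j. l < t \<Longrightarrow> i < k \<Longrightarrow> j < k \<Longrightarrow> (\<Sum>x<n. \<Sum>y<n. u i x * u j y * B l x y) = 0"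
  shows "\<exists>v. (\<forall>c. (\<forall>x<n. (\<Sum>a<k. c a * v a x) = 0) \<longrightarrow> (\<forall>a<k. c a = 0)) \<and>
    (\<forall>l<t. \<forall>a<k. \<forall>b<k. (\<Sum>x<n. \<Sum>y<n. v a x * v b y * \<phi> l x y) = 0)"
proof -
  have "\<exists>C v p. \<forall>a<m. (\<forall>x<n. (\<Sum>i<k. C a i * u i x, v a x) \<in> G) \<and> p a < n \<and> v a (p a) = 1 \<and>
      (\<forall>b<a. v a (p b) = 0)" if "m \<le> k" for m
    using that
  proof (induction m)
    case (Suc m)
    then obtain C v p where IH': "\<forall>a<m. (\<forall>x<n. (\<Sum>i<k. C a i * u i x, v a x) \<in> G) \<and> p a < n \<and>
        v a (p a) = 1 \<and> (\<forall>b<a. v a (p b) = 0)"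
      by auto
    then have IH: "\<And>a x. a < m \<Longrightarrow> x < n \<Longrightarrow> (\<Sum>i<k. C a i * u i x, v a x) \<in> G"
      "\<And>a. a < m \<Longrightarrow> p a < n" "\<And>a. a < m \<Longrightarrow> v a (p a) = 1" "\<And>a b. a < m \<Longrightarrow> b < a \<Longrightarrow> v a (p b) = 0"
      by blast+
    obtain c where c: "\<exists>i\<in>{..<k}. c i \<noteq> 0" "\<forall>b\<in>{..<m}. (\<Sum>i<k. c i * u i (p b)) = 0"
      using homogeneous_system_nontrivial_solution[of "{..<m}" "{..<k}" "\<lambda>i b. u i (p b)"] Suc.prems
      by auto
    define z where "z x = (\<Sum>i<k. c i * u i x)" for x
    \<comment> \<open>The \<open>u i\<close> restrict to unit vectors on the first \<open>k\<close>
      coordinates, so a nontrivial combination of them is not the zero vector.\<close>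
    have z: "z x = c x" if "x < k" for x
    proof -
      have "z x = (\<Sum>i<k. if i = x then c i else 0)"
        unfolding z_def using that u by (intro sum.cong) auto
      then show ?thesis using that by simp
    qed
    define S where "S = {x. x < n \<and> z x \<noteq> 0}"
    obtain i where i: "i < k" "c i \<noteq> 0"
      using c(1) by blast
    then have "i \<in> S"
      using z[of i] \<open>k \<le> n\<close> by (simp add: S_def)
    then have "S \<noteq> {}" by blast
    have "finite S" by (simp add: S_def)
    have "\<exists>x0\<in>S. \<forall>x\<in>S. z x / z x0 \<in> Domain G"
      by (rule valuation_pivot[OF G val \<open>finite S\<close> \<open>S \<noteq> {}\<close>]) (simp add: S_def)
    then obtain x0 where x0: "x0 \<in> S" "\<forall>x\<in>S. z x / z x0 \<in> Domain G"
      by blast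
    have "z x / z x0 \<in> Domain G" if "x < n" for x
      using that x0(2) partial_ring_hom_zero[OF G] by (cases "x \<in> S") (auto simp: S_def)
    then have "\<forall>x. \<exists>y. x < n \<longrightarrow> (z x / z x0, y) \<in> G"
      by blast
    from choice[OF this] obtain d where d: "\<And>x. x < n \<Longrightarrow> (z x / z x0, d x) \<in> G"
      by blast
    let ?C = "C(m := \<lambda>i. c i / z x0)" and ?v = "v(m := d)" and ?p = "p(m := x0)"
    have zx: "(\<Sum>i<k. c i * u i x / z x0) = z x / z x0" for x
      by (simp add: z_def sum_divide_distrib)
    \<comment> \<open>Entries that are exactly 0 or 1 before reduction stay so, because the graph
      \<open>G\<close> is single-valued. The matrix of the \<open>v a\<close> at the pivots is
      therefore unitriangular.\<close>
    have d0: "d (p b) = 0" if "b < m" for b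
      using d[OF IH(2)[OF that]] c(2) that partial_ring_hom_unique[OF G _ partial_ring_hom_zero[OF G]]
      by (simp add: z_def)
    have d1: "d x0 = 1"
      using d[of x0] x0(1) partial_ring_hom_unique[OF G _ partial_ring_hom_one[OF G]]
      by (simp add: S_def)
    have "(\<forall>x<n. (\<Sum>i<k. ?C a i * u i x, ?v a x) \<in> G) \<and> ?p a < n \<and> ?v a (?p a) = 1 \<and>
      (\<forall>b<a. ?v a (?p b) = 0)" if "a < Suc m" for a
    proof (cases "a = m")
      case True
      then show ?thesis using d d0 d1 x0(1) by (auto simp: zx S_def)
    next
      case False
      with that IH show ?thesis by auto
    qed
    then show ?case by (intro exI[of _ ?C] exI[of _ ?v] exI[of _ ?p]) blast
  qed auto
  from this[OF order_refl] obtain C v p where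
    vp: "\<forall>a<k. (\<forall>x<n. (\<Sum>i<k. C a i * u i x, v a x) \<in> G) \<and> p a < n \<and> v a (p a) = 1 \<and>
      (\<forall>b<a. v a (p b) = 0)"
    by blast
  then have v: "\<And>a x. a < k \<Longrightarrow> x < n \<Longrightarrow> (\<Sum>i<k. C a i * u i x, v a x) \<in> G"
    and p: "\<And>a. a < k \<Longrightarrow> p a < n" "\<And>a. a < k \<Longrightarrow> v a (p a) = 1" "\<And>a b. a < k \<Longrightarrow> b < a \<Longrightarrow> v a (p b) = 0"
    by blast+
  show ?thesis
  proof (intro exI[of _ v] conjI allI impI)
    fix c and a :: nat assume c: "\<forall>x<n. (\<Sum>a<k. c a * v a x) = 0" and "a < k"
    then show "c a = 0"
    proof (induction a rule: less_induct)
      case (less a)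
      have "0 = (\<Sum>b<k. c b * v b (p a))"
        using less.prems p(1) by simp
      also have "\<dots> = (\<Sum>b<k. if b = a then c a else 0)"
      proof (intro sum.cong refl)
        fix b assume "b \<in> {..<k}"
        then show "c b * v b (p a) = (if b = a then c a else 0)"
          using less p(2,3) by (cases b a rule: linorder_cases) auto
      qed
      finally show ?case
        using less.prems by simp
    qed
  next
    fix l a b assume l: "l < t" and a: "a < k" and b: "b < k"
    define U where "U a x = (\<Sum>i<k. C a i * u i x)" for a x
    have "(\<Sum>x<n. \<Sum>y<n. U a x * U b y * B l x y, \<Sum>x<n. \<Sum>y<n. v a x * v b y * \<phi> l x y) \<in> G"
      using v a b B l by (intro partial_ring_hom_sum[OF G] partial_ring_hom_mult[OF G]) (auto simp: U_def)
    moreover have "(\<Sum>x<n. \<Sum>y<n. U a x * U b y * B l x y) = 0"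
    proof -
      have "(\<Sum>x<n. \<Sum>y<n. U a x * U b y * B l x y) =
          (\<Sum>x<n. \<Sum>y<n. \<Sum>i<k. \<Sum>j<k. C a i * C b j * (u i x * u j y * B l x y))"
        unfolding U_def
        by (intro sum.cong refl, subst sum_product) (simp only: sum_distrib_right sum_distrib_left mult_ac)
      also have "\<dots> = (\<Sum>i<k. \<Sum>j<k. \<Sum>x<n. \<Sum>y<n. C a i * C b j * (u i x * u j y * B l x y))"
        by (rule sum_swap_pairs)
      also have "\<dots> = 0"
        unfolding sum_distrib_left[symmetric] using iso[OF l] by simp
      finally show ?thesis .
    qed
    ultimately show "(\<Sum>x<n. \<Sum>y<n. v a x * v b y * \<phi> l x y) = 0"
      using G by (simp add: partial_ring_hom_def)
  qed
qed

lemma common_isotropic_subspace: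
  fixes \<phi> :: "nat \<Rightarrow> nat \<Rightarrow> nat \<Rightarrow> 'k::alg_closed_field"
  assumes t: "t \<ge> 2" and kn: "k \<le> n" and dim: "t * (k - 1) \<le> 2 * (n - k)"
    and diag: "\<And>l x. l < t \<Longrightarrow> x < n \<Longrightarrow> \<phi> l x x = 0"
    and skew: "\<And>l x y. l < t \<Longrightarrow> x < n \<Longrightarrow> y < n \<Longrightarrow> \<phi> l x y = - \<phi> l y x"
  shows "\<exists>v. (\<forall>c. (\<forall>x<n. (\<Sum>a<k. c a * v a x) = 0) \<longrightarrow> (\<forall>a<k. c a = 0)) \<and>
    (\<forall>l<t. \<forall>a<k. \<forall>b<k. (\<Sum>x<n. \<Sum>y<n. v a x * v b y * \<phi> l x y) = 0)"
proof -
  define w where "w = n - k"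
  have n: "n = k + w" using kn by (simp add: w_def)
  obtain \<psi> :: "nat \<Rightarrow> nat \<Rightarrow> nat \<Rightarrow> 'k" where \<psi>: "nondegenerate t k w \<psi>"
    using nondegenerate_exists[OF t dim[folded w_def]] by blast
  \<comment> \<open>The starting tuple: the span of the first \<open>k\<close> unit vectors is
    isotropic, and its pairing with the other unit vectors is \<open>\<psi>\<close>.\<close>
  define \<phi>0 where "\<phi>0 l x y = (if x < k \<and> k \<le> y then \<psi> l x (y - k)
      else if k \<le> x \<and> y < k then - \<psi> l y (x - k) else 0)" for l x y
  define \<theta> where "\<theta> l x y = \<phi> l x y - \<phi>0 l x y" for l x y
  obtain u :: "nat \<Rightarrow> nat \<Rightarrow> 'k fps" where
    u: "\<And>i x. i < k \<Longrightarrow> x < k \<Longrightarrow> u i x = (if x = i then 1 else 0)" and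
    eq: "\<And>l i j. \<lbrakk>l < t; i < k; j < k; i < j\<rbrakk> \<Longrightarrow>
      (\<Sum>c<w. fps_const (\<psi> l i c) * u j (k + c) - fps_const (\<psi> l j c) * u i (k + c)) =
      - fps_X * (\<Sum>x<n. \<Sum>y<n. fps_const (\<theta> l x y) * (u i x * u j y))"
    using formal_deformation[OF \<psi>, where n = n and \<theta> = \<theta>] by blast
  define b where "b l x y = fps_const (\<phi>0 l x y) + fps_X * fps_const (\<theta> l x y)" for l x y
  have \<phi>0_diag: "\<phi>0 l x x = 0" and \<phi>0_skew: "\<phi>0 l x y = - \<phi>0 l y x" for l x y
    by (auto simp: \<phi>0_def)
  have b_diag: "b l x x = 0" if "l < t" "x < n" for l x
    using diag[OF that] by (simp add: b_def \<theta>_def \<phi>0_diag)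
  have b_skew: "b l x y = - b l y x" if "l < t" "x < n" "y < n" for l x y
  proof (rule fps_ext)
    show "fps_nth (b l x y) m = fps_nth (- b l y x) m" for m
      using skew[OF that] \<phi>0_skew[of l x y] by (simp add: b_def \<theta>_def)
  qed
  have iso_less: "(\<Sum>x<n. \<Sum>y<n. u i x * u j y * b l x y) = 0"
    if "l < t" "i < k" "j < k" "i < j" for l i j
  proof -
    have split_sum: "(\<Sum>x<n. f x) = (\<Sum>x<k. f x) + (\<Sum>c<w. f (k + c))" for f :: "nat \<Rightarrow> 'k fps"
      unfolding n by (induction w) (simp_all add: add.assoc)
    have "(\<Sum>x<n. \<Sum>y<n. u i x * u j y * fps_const (\<phi>0 l x y)) =
       (\<Sum>c<w. fps_const (\<psi> l i c) * u j (k + c) - fps_const (\<psi> l j c) * u i (k + c))"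
    proof -
      have d: "(\<Sum>x<k. u i x * f x) = f i" if "i < k" for f i
      proof -
        have "(\<Sum>x<k. u i x * f x) = (\<Sum>x<k. if x = i then f x else 0)"
          using that u by (intro sum.cong) auto
        then show ?thesis using that by simp
      qed
      have "(\<Sum>x<n. \<Sum>y<n. u i x * u j y * fps_const (\<phi>0 l x y)) =
          (\<Sum>x<k. u i x * (\<Sum>c<w. u j (k + c) * fps_const (\<psi> l x c))) +
          (\<Sum>c<w. u i (k + c) * (\<Sum>y<k. u j y * fps_const (- \<psi> l y c)))"
        unfolding split_sum by (simp add: \<phi>0_def sum_distrib_left mult.assoc)
      also have "\<dots> = (\<Sum>c<w. u j (k + c) * fps_const (\<psi> l i c)) +
          (\<Sum>c<w. u i (k + c) * fps_const (- \<psi> l j c))"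
        using that by (simp only: d)
      finally show ?thesis
        by (simp add: sum_subtractf sum_negf mult.commute flip: fps_const_neg)
    qed
    moreover have "(\<Sum>x<n. \<Sum>y<n. u i x * u j y * b l x y) =
        (\<Sum>x<n. \<Sum>y<n. u i x * u j y * fps_const (\<phi>0 l x y)) +
        fps_X * (\<Sum>x<n. \<Sum>y<n. fps_const (\<theta> l x y) * (u i x * u j y))"
      by (simp add: b_def distrib_left sum.distrib sum_distrib_left mult_ac)
    ultimately show ?thesis
      using eq[OF that] by simp
  qed
  have iso: "(\<Sum>x<n. \<Sum>y<n. u i x * u j y * b l x y) = 0" if l: "l < t" and ij: "i < k" "j < k" for l i j
  proof (cases i j rule: linorder_cases)
    case less
    then show ?thesis by (rule iso_less[OF l ij])
  next
    case greater
    have "(\<Sum>x<n. \<Sum>y<n. u i x * u j y * b l x y) = (\<Sum>y<n. \<Sum>x<n. u i x * u j y * b l x y)"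
      by (rule sum.swap)
    also have "\<dots> = (\<Sum>y<n. \<Sum>x<n. - (u j y * u i x * b l y x))"
      by (intro sum.cong refl, subst b_skew[OF l]) (simp_all add: mult_ac)
    also have "\<dots> = 0"
      using iso_less[OF l ij(2,1) greater] by (simp add: sum_negf)
    finally show ?thesis .
  next
    case equal
    \<comment> \<open>Skew-symmetry would give only twice the value, which is useless in
      characteristic 2. Growing the square one row and column at a time cancels the off-diagonal
      terms in pairs and uses \<open>b_diag\<close> for the rest.\<close>
    have "(\<Sum>x<m. \<Sum>y<m. u i x * u i y * b l x y) = 0" if "m \<le> n" for m
      using that
    proof (induction m)
      case (Suc m)
      have "(\<Sum>x<m. u i m * u i x * b l m x) = - (\<Sum>x<m. u i x * u i m * b l x m)"
        unfolding sum_negf[symmetric] using Suc.prems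
        by (intro sum.cong refl) (simp add: b_skew[OF l, of m] mult_ac)
      then show ?case
        using Suc b_diag[OF l, of m] by (simp add: sum.distrib)
    qed simp
    then show ?thesis using equal by simp
  qed
  \<comment> \<open>The form \<open>b\<close> specialises to \<open>\<phi>\<close> at \<open>fps_X = 1\<close>. Evaluation at 1 makes sense only for
    polynomials, but Chevalley's theorem extends it to a valuation ring of the field of Laurent
    series.\<close>
  define ev where "ev p = (fps_to_fls (fps_of_poly p), poly p 1)" for p :: "'k poly"
  have "partial_ring_hom (range ev)"
    unfolding partial_ring_hom_def
  proof (intro conjI allI impI)
    have "ev 1 = (1, 1)" by (simp add: ev_def)
    then show "(1, 1) \<in> range ev" by (metis rangeI)
  next
    fix c assume "(0, c) \<in> range ev"
    then show "c = 0" by (auto simp: ev_def)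
  next
    fix a c a' c' assume "(a, c) \<in> range ev" "(a', c') \<in> range ev"
    then obtain p q where pq: "(a, c) = ev p" "(a', c') = ev q" by blast
    then have "(a - a', c - c') = ev (p - q)" "(a * a', c * c') = ev (p * q)"
      by (auto simp: ev_def fps_of_poly_diff fps_of_poly_mult fls_times_fps_to_fls)
    then show "(a - a', c - c') \<in> range ev" "(a * a', c * c') \<in> range ev"
      by auto
  qed
  moreover have "Range (range ev) = UNIV"
  proof -
    have "(fst (ev [:c:]), c) \<in> range ev" for c
      by (rule range_eqI[of _ _ "[:c:]"]) (simp add: ev_def)
    then show ?thesis by blast
  qed
  ultimately obtain G where G: "range ev \<subseteq> G" "partial_ring_hom G"
    "\<And>x. x \<in> Domain G \<or> inverse x \<in> Domain G"
    using chevalley_extension by blast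
  show ?thesis
  proof (rule specialize_isotropic[OF G(2,3) kn, where u = "\<lambda>i x. fps_to_fls (u i x)"
        and B = "\<lambda>l x y. fps_to_fls (b l x y)"])
    show "fps_to_fls (u i x) = (if x = i then 1 else 0)" if "i < k" "x < k" for i x
      using u[OF that] by simp
    show "(fps_to_fls (b l x y), \<phi> l x y) \<in> G" for l x y
    proof -
      have "(fps_to_fls (b l x y), \<phi> l x y) = ev [:\<phi>0 l x y, \<theta> l x y:]"
        by (simp add: ev_def b_def \<theta>_def fps_of_poly_pCons mult.commute)
      then show ?thesis using G(1) by auto
    qed
    fix l i j assume *: "l < t" "i < k" "j < k"
    have hom: "fps_to_fls (\<Sum>x\<in>A. f x) = (\<Sum>x\<in>A. fps_to_fls (f x))" for A :: "nat set" and f :: "nat \<Rightarrow> 'k fps"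
      by (induction A rule: infinite_finite_induct) auto
    show "(\<Sum>x<n. \<Sum>y<n. fps_to_fls (u i x) * fps_to_fls (u j y) * fps_to_fls (b l x y)) = 0"
      using arg_cong[OF iso[OF *], of fps_to_fls] by (simp add: hom fls_times_fps_to_fls)
  qed
qed

section \<open>Commutative subalgebras of two-step nilpotent Lie algebras\<close>

context lie_algebra
begin

lemma bracket_add_left: "bracket (x + x') y = bracket x y + bracket x' y"
  and bracket_scale_left: "bracket (smul c x) y = smul c (bracket x y)"
  and bracket_add_right: "bracket y (x + x') = bracket y x + bracket y x'"
  and bracket_scale_right: "bracket y (smul c x) = smul c (bracket y x)"
  using bracket_linear_left[of y] bracket_linear_right[of y] unfolding Vector_Spaces.linear_iff by simp_all

lemma bracket_zero_left: "bracket 0 y = 0" and bracket_zero_right: "bracket y 0 = 0"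
  using bracket_scale_left[of 0 0 y] bracket_scale_right[of y 0 0] by simp_all

lemma bracket_sum_left: "bracket (\<Sum>i\<in>I. f i) y = (\<Sum>i\<in>I. bracket (f i) y)"
  by (induction I rule: infinite_finite_induct) (auto simp: bracket_add_left bracket_zero_left)

lemma bracket_sum_right: "bracket y (\<Sum>i\<in>I. f i) = (\<Sum>i\<in>I. bracket y (f i))"
  by (induction I rule: infinite_finite_induct) (auto simp: bracket_add_right bracket_zero_right)

lemma bracket_skew: "bracket x y = - bracket y x"
  using bracket_self[of "x + y"] unfolding bracket_add_left bracket_add_right
  by (simp add: bracket_self eq_neg_iff_add_eq_0 add.commute)

lemma bracket_span_zero:
  assumes "\<And>x y. x \<in> S \<Longrightarrow> y \<in> S \<Longrightarrow> bracket x y = 0" and "x \<in> span S" "y \<in> span S"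
  shows "bracket x y = 0"
proof -
  have *: "bracket x y = 0" if "x \<in> S" for x
    using \<open>y \<in> span S\<close>
  proof (induction rule: span_induct)
    case base
    show ?case by (auto simp: subspace_def bracket_zero_right bracket_add_right bracket_scale_right)
  qed (use assms(1) that in auto)
  show ?thesis
    using \<open>x \<in> span S\<close>
  proof (induction rule: span_induct)
    case base
    show ?case by (auto simp: subspace_def bracket_zero_left bracket_add_left bracket_scale_left)
  qed (use * in auto)
qed

end

text \<open>The coordinates of brackets of a basis modulo \<open>D\<close> are \<open>t\<close>
  alternating forms. Lifts of a common isotropic basis commute, and adjoining a basis of the central
  subspace \<open>D\<close> contributes the remaining \<open>t\<close> dimensions.\<close>

lemma commutative_subalgebra_exists:
  fixes smul :: "'k::alg_closed_field \<Rightarrow> 'l::ab_group_add \<Rightarrow> 'l"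
  assumes L: "nilp2_class smul bracket n t" and t: "t \<ge> 2"
    and kn: "k \<le> n" and dim: "t * (k - 1) \<le> 2 * (n - k)"
  shows "has_commutative_subalgebra smul bracket (k + t)"
proof -
  interpret lie_algebra smul bracket
    using L by (simp add: nilp2_class_def)
  define D where "D = derived_algebra smul bracket"
  have D: "subspace D" and bracket_D: "bracket x y \<in> D" for x y
    unfolding D_def derived_algebra_def bracket_span_def by (auto intro: span_base)
  have central: "bracket x y = 0" if "x \<in> D" for x y
  proof -
    have "bracket x y \<in> bracket_span smul bracket D UNIV"
      unfolding bracket_span_def using that by (auto intro: span_base)
    then show ?thesis
      using L by (simp add: nilp2_class_def two_step_nilpotent_def D_def)
  qed
  obtain B0 where B0: "finite B0" "span B0 = D"
    using L by (auto simp: nilp2_class_def D_def)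
  obtain Z where Z: "Z \<subseteq> D" "independent Z" "D \<subseteq> span Z" "card Z = dim D"
    using basis_exists[of D] by blast
  have "finite Z"
    using independent_span_bound[OF B0(1) Z(2)] Z(1) B0(2) by simp
  have "card Z = t"
    using L Z(4) by (simp add: nilp2_class_def D_def)
  obtain z where z: "bij_betw z {..<t} Z"
    using ex_bij_betw_nat_finite[OF \<open>finite Z\<close>] \<open>card Z = t\<close> by (auto simp: lessThan_atLeast0)
  obtain B where B: "finite B" "card B = n" "\<And>c. (\<Sum>b\<in>B. smul (c b) b) \<in> D \<Longrightarrow> \<forall>b\<in>B. c b = 0"
    using L by (auto simp: nilp2_class_def quotient_has_dim_def D_def)
  obtain b where b: "bij_betw b {..<n} B"
    using ex_bij_betw_nat_finite[OF B(1)] B(2) by (auto simp: lessThan_atLeast0)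
  have b_indep: "c x = 0" if "(\<Sum>x<n. smul (c x) (b x)) \<in> D" "x < n" for c x
  proof -
    have inv: "inv_into {..<n} b (b x) = x" if "x < n" for x
      using bij_betw_inv_into_left[OF b] that by simp
    have "(\<Sum>y\<in>B. smul (c (inv_into {..<n} b y)) y) = (\<Sum>x<n. smul (c x) (b x))"
      by (subst sum.reindex_bij_betw[OF b, symmetric]) (simp add: inv)
    then have "\<forall>y\<in>B. c (inv_into {..<n} b y) = 0"
      using that(1) by (intro B(3)) simp
    moreover have "b x \<in> B" using b that(2) by (auto dest: bij_betwE)
    ultimately show ?thesis using inv[OF that(2)] by auto
  qed
  define \<phi> where "\<phi> l x y = representation Z (bracket (b x) (b y)) (z l)" for l x y
  have in_span: "bracket x y \<in> span Z" for x y
    using bracket_D Z(3) by blast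
  have \<phi>: "bracket (b x) (b y) = (\<Sum>l<t. smul (\<phi> l x y) (z l))" for x y
  proof -
    have "bracket (b x) (b y) = (\<Sum>u\<in>Z. smul (representation Z (bracket (b x) (b y)) u) u)"
      using sum_representation_eq[OF Z(2) in_span \<open>finite Z\<close>] by simp
    also have "\<dots> = (\<Sum>l<t. smul (\<phi> l x y) (z l))"
      unfolding \<phi>_def by (rule sum.reindex_bij_betw[OF z, symmetric])
    finally show ?thesis .
  qed
  have "\<exists>v. (\<forall>c. (\<forall>x<n. (\<Sum>a<k. c a * v a x) = 0) \<longrightarrow> (\<forall>a<k. c a = 0)) \<and>
      (\<forall>l<t. \<forall>a<k. \<forall>b<k. (\<Sum>x<n. \<Sum>y<n. v a x * v b y * \<phi> l x y) = 0)"
  proof (rule common_isotropic_subspace[OF t kn dim])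
    show "\<phi> l x x = 0" for l x
      by (simp add: \<phi>_def bracket_self representation_zero)
    show "\<phi> l x y = - \<phi> l y x" for l x y
      unfolding \<phi>_def by (subst bracket_skew) (simp add: representation_neg[OF Z(2) in_span])
  qed
  then obtain v where v_indep: "\<And>c a. \<forall>x<n. (\<Sum>a<k. c a * v a x) = 0 \<Longrightarrow> a < k \<Longrightarrow> c a = 0"
    and v_iso: "\<And>l a b. l < t \<Longrightarrow> a < k \<Longrightarrow> b < k \<Longrightarrow> (\<Sum>x<n. \<Sum>y<n. v a x * v b y * \<phi> l x y) = 0"
    by blast
  define X where "X a = (\<Sum>x<n. smul (v a x) (b x))" for a
  have X_comm: "bracket (X a) (X a') = 0" if "a < k" "a' < k" for a a'
  proof -
    have "bracket (X a) (X a') = (\<Sum>x<n. \<Sum>y<n. smul (v a x * v a' y) (bracket (b x) (b y)))"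
      unfolding X_def bracket_sum_left
      by (simp add: bracket_sum_right bracket_scale_left bracket_scale_right scale_sum_right
          mult.commute)
    also have "\<dots> = (\<Sum>x<n. \<Sum>y<n. \<Sum>l<t. smul (v a x * v a' y * \<phi> l x y) (z l))"
      by (simp add: \<phi> scale_sum_right)
    also have "\<dots> = (\<Sum>x<n. \<Sum>l<t. \<Sum>y<n. smul (v a x * v a' y * \<phi> l x y) (z l))"
      by (intro sum.cong refl sum.swap)
    also have "\<dots> = (\<Sum>l<t. \<Sum>x<n. \<Sum>y<n. smul (v a x * v a' y * \<phi> l x y) (z l))"
      by (rule sum.swap)
    also have "\<dots> = (\<Sum>l<t. smul (\<Sum>x<n. \<Sum>y<n. v a x * v a' y * \<phi> l x y) (z l))"
      by (simp add: scale_sum_left)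
    finally show ?thesis
      using v_iso that by simp
  qed
  have X_indep: "c a = 0" if "(\<Sum>a<k. smul (c a) (X a)) \<in> D" "a < k" for c a
  proof (rule v_indep[OF _ that(2)], intro allI impI)
    fix x assume "x < n"
    have "(\<Sum>a<k. smul (c a) (X a)) = (\<Sum>a<k. \<Sum>x<n. smul (c a * v a x) (b x))"
      by (simp add: X_def scale_sum_right)
    also have "\<dots> = (\<Sum>x<n. smul (\<Sum>a<k. c a * v a x) (b x))"
      by (subst sum.swap) (simp add: scale_sum_left)
    finally show "(\<Sum>a<k. c a * v a x) = 0"
      using b_indep[of "\<lambda>x. \<Sum>a<k. c a * v a x" x] that(1) \<open>x < n\<close> by simp
  qed
  have X_inj: "inj_on X {..<k}"
  proof (rule inj_onI, rule ccontr)
    fix a a' assume *: "a \<in> {..<k}" "a' \<in> {..<k}" "X a = X a'" "a \<noteq> a'"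
    let ?c = "\<lambda>i. (if i = a then 1 else 0) - (if i = a' then 1 else 0) :: 'k"
    have "(\<Sum>i<k. smul (?c i) (X i)) = (\<Sum>i<k. (if i = a then X i else 0) - (if i = a' then X i else 0))"
      by (intro sum.cong refl) auto
    also have "\<dots> = 0"
      using * by (simp add: sum_subtractf)
    finally have "?c a = 0"
      using X_indep[of ?c a] subspace_0[OF D] * by auto
    then show False using * by simp
  qed
  have X_notin: "X a \<notin> D" if "a < k" for a
  proof
    assume "X a \<in> D"
    moreover have "(\<Sum>i<k. smul (if i = a then 1 else 0) (X i)) = (\<Sum>i<k. if i = a then X i else 0)"
      by (intro sum.cong refl) auto
    ultimately show False
      using X_indep[of "\<lambda>i. if i = a then 1 else 0" a] that by simp
  qed
  define S where "S = X ` {..<k} \<union> Z"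
  have disj: "X ` {..<k} \<inter> Z = {}"
    using X_notin Z(1) by auto
  have "finite S" using \<open>finite Z\<close> by (simp add: S_def)
  have "independent S"
  proof (rule independent_if_scalars_zero[OF \<open>finite S\<close>])
    fix f x assume f: "(\<Sum>x\<in>S. smul (f x) x) = 0" and "x \<in> S"
    have split: "(\<Sum>x\<in>S. smul (f x) x) = (\<Sum>a<k. smul (f (X a)) (X a)) + (\<Sum>u\<in>Z. smul (f u) u)"
      unfolding S_def using disj \<open>finite Z\<close>
      by (subst sum.union_disjoint) (auto simp: sum.reindex[OF X_inj])
    have "(\<Sum>u\<in>Z. smul (f u) u) \<in> D"
      using Z(1) by (intro subspace_sum[OF D] subspace_scale[OF D]) auto
    moreover have "(\<Sum>a<k. smul (f (X a)) (X a)) = - (\<Sum>u\<in>Z. smul (f u) u)"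
      using f split by (simp add: eq_neg_iff_add_eq_0)
    ultimately have "(\<Sum>a<k. smul (f (X a)) (X a)) \<in> D"
      using subspace_neg[OF D] by simp
    then have fX: "f (X a) = 0" if "a < k" for a
      using X_indep[of "\<lambda>a. f (X a)" a] that by simp
    then have "(\<Sum>u\<in>Z. smul (f u) u) = 0"
      using f split by simp
    then have "f u = 0" if "u \<in> Z" for u
      using independentD[OF Z(2) \<open>finite Z\<close> order_refl] that by blast
    with fX \<open>x \<in> S\<close> show "f x = 0"
      by (auto simp: S_def)
  qed
  moreover have "card S = k + t"
    unfolding S_def using disj \<open>finite Z\<close> \<open>card Z = t\<close>
    by (subst card_Un_disjoint) (auto simp: card_image[OF X_inj])
  ultimately have "dim (span S) = k + t"
    using dim_span_eq_card_independent by simp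
  moreover have "bracket x y = 0" if "x \<in> span S" "y \<in> span S" for x y
  proof (rule bracket_span_zero[OF _ that])
    fix x y assume "x \<in> S" "y \<in> S"
    then show "bracket x y = 0"
      using X_comm central Z(1) bracket_skew[of x y] by (auto simp: S_def)
  qed
  ultimately show ?thesis
    unfolding has_commutative_subalgebra_def
    by (intro exI[of _ "span S"]) (auto simp: span_zero)
qed

section \<open>Polynomial relations by counting monomials\<close>

lemma poly_nonroot:
  fixes p :: "'k::field poly"
  assumes "infinite (UNIV :: 'k set)" "p \<noteq> 0"
  shows "\<exists>s. poly p s \<noteq> 0"
  using poly_roots_finite[OF assms(2)] assms(1)
  by (metis (mono_tags, lifting) UNIV_eq_I mem_Collect_eq)

text \<open>A property weaker than being a polynomial function, but enough over an infinite field to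
  find common nonzeros, and shared by homogeneous polynomials and minors.\<close>

definition line_poly :: "(('i \<Rightarrow> 'k::field) \<Rightarrow> 'k) \<Rightarrow> bool" where
  "line_poly g \<longleftrightarrow> (\<forall>x y. \<exists>p. \<forall>s. g (\<lambda>i. x i + s * (y i - x i)) = poly p s)"

text \<open>Moving along the line from a point where \<open>\<G>\<close> is nonzero to one where \<open>g\<close> is nonzero.\<close>

lemma common_nonzero:
  fixes \<G> :: "(('i \<Rightarrow> 'k::field) \<Rightarrow> 'k) set"
  assumes inf: "infinite (UNIV :: 'k set)" and "finite \<G>"
    and "\<And>g. g \<in> \<G> \<Longrightarrow> line_poly g" "\<And>g. g \<in> \<G> \<Longrightarrow> \<exists>x. g x \<noteq> 0"
  shows "\<exists>x. \<forall>g\<in>\<G>. g x \<noteq> 0"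
  using assms(2-)
proof (induction rule: finite_induct)
  case (insert g \<G>)
  have "\<exists>x. \<forall>h\<in>\<G>. h x \<noteq> 0"
    using insert.prems by (intro insert.IH) simp_all
  then obtain x where x: "\<forall>h\<in>\<G>. h x \<noteq> 0" by blast
  obtain y where y: "g y \<noteq> 0"
    using insert.prems(2)[of g] by blast
  have "\<forall>h\<in>insert g \<G>. \<exists>p. \<forall>s. h (\<lambda>i. x i + s * (y i - x i)) = poly p s"
    using insert.prems(1) by (simp add: line_poly_def)
  from bchoice[OF this] obtain p where
    p: "\<And>h s. h \<in> insert g \<G> \<Longrightarrow> h (\<lambda>i. x i + s * (y i - x i)) = poly (p h) s" by blast
  have "p h \<noteq> 0" if "h \<in> insert g \<G>" for h
  proof (cases "h = g")
    case True
    then have "poly (p h) 1 \<noteq> 0" using p[OF that, of 1] y by simp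
    then show ?thesis by auto
  next
    case False
    then have "h x \<noteq> 0" using x that by blast
    then have "poly (p h) 0 \<noteq> 0" using p[OF that, of 0] by simp
    then show ?thesis by auto
  qed
  then have "prod p (insert g \<G>) \<noteq> 0"
    using insert.hyps by (subst prod_zero_iff) auto
  then obtain s where "poly (prod p (insert g \<G>)) s \<noteq> 0"
    using poly_nonroot[OF inf] by blast
  then have "\<forall>h\<in>insert g \<G>. poly (p h) s \<noteq> 0"
    using insert.hyps by (auto simp: poly_prod)
  then show ?case
    using p by (intro exI[of _ "\<lambda>i. x i + s * (y i - x i)"]) simp
qed auto

lemma line_poly_hom_poly_eval: "line_poly (hom_poly_eval d f)"
  unfolding line_poly_def
proof (intro allI)
  fix x y :: "'a \<Rightarrow> 'b"
  show "\<exists>p. \<forall>s. hom_poly_eval d f (\<lambda>i. x i + s * (y i - x i)) = poly p s"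
    by (rule exI[of _ "\<Sum>m | (\<Sum>i\<in>UNIV. m i) = d. [:f m:] * (\<Prod>i\<in>UNIV. [:x i, y i - x i:] ^ m i)"])
      (simp add: hom_poly_eval_def poly_sum poly_prod)
qed

lemma line_poly_det:
  fixes c :: "'n::finite \<Rightarrow> 'n \<Rightarrow> 'i"
  shows "line_poly (\<lambda>x :: 'i \<Rightarrow> 'k::field. det (\<chi> r r'. x (c r r')))"
  unfolding line_poly_def
proof (intro allI)
  fix x y :: "'i \<Rightarrow> 'k"
  show "\<exists>p. \<forall>s. det (\<chi> r r'. x (c r r') + s * (y (c r r') - x (c r r'))) = poly p s"
    by (rule exI[of _ "\<Sum>\<pi> | \<pi> permutes UNIV. [:of_int (sign \<pi>):] *
        (\<Prod>r\<in>UNIV. [:x (c r (\<pi> r)), y (c r (\<pi> r)) - x (c r (\<pi> r)):])"])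
      (simp add: det_def poly_sum poly_prod)
qed

text \<open>Terms are grouped by their exponent at \<open>j\<close>. The group with exponent
  \<open>m0 j\<close> is nonzero at some \<open>x\<close> by induction, so along variable
  \<open>j\<close> there remains a nonzero polynomial in one variable.\<close>

lemma polynomial_nonzero_value:
  fixes f :: "('i \<Rightarrow> nat) \<Rightarrow> 'k::field"
  assumes inf: "infinite (UNIV :: 'k set)" and "finite S"
    and "finite E" "m0 \<in> E" "f m0 \<noteq> 0" "\<And>m i. m \<in> E \<Longrightarrow> i \<notin> S \<Longrightarrow> m i = 0"
  shows "\<exists>x. (\<Sum>m\<in>E. f m * (\<Prod>i\<in>S. x i ^ m i)) \<noteq> 0"
  using assms(2-)
proof (induction S arbitrary: E f m0 rule: finite_induct)
  case empty
  have "m = m0" if "m \<in> E" for m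
    using empty.prems(2,4) that by (intro ext) (metis emptyE)
  then have "E = {m0}" using empty.prems(2) by blast
  then show ?case using empty.prems(3) by simp
next
  case (insert j S)
  define E0 where "E0 = {m \<in> E. m j = m0 j}"
  define r where "r m = m(j := 0)" for m :: "'i \<Rightarrow> nat"
  have r_inv: "(r m)(j := m0 j) = m" if "m \<in> E0" for m
    using that by (auto simp: r_def E0_def)
  have inj: "inj_on r E0"
    using r_inv by (metis inj_onI)
  have "\<exists>x. (\<Sum>m\<in>r ` E0. f (m(j := m0 j)) * (\<Prod>i\<in>S. x i ^ m i)) \<noteq> 0"
  proof (rule insert.IH)
    show "finite (r ` E0)" using insert.prems(1) by (simp add: E0_def)
    show "r m0 \<in> r ` E0" using insert.prems(2) by (simp add: E0_def)
    show "f ((r m0)(j := m0 j)) \<noteq> 0"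
      using insert.prems(2,3) r_inv[of m0] by (simp add: E0_def)
    show "m i = 0" if "m \<in> r ` E0" "i \<notin> S" for m i
      using that insert.prems(4) by (auto simp: r_def E0_def)
  qed
  then obtain x where x: "(\<Sum>m\<in>E0. f m * (\<Prod>i\<in>S. x i ^ r m i)) \<noteq> 0"
    by (auto simp: sum.reindex[OF inj] r_inv)
  define q where "q m = f m * (\<Prod>i\<in>S. x i ^ m i)" for m
  have "(\<Prod>i\<in>S. x i ^ r m i) = (\<Prod>i\<in>S. x i ^ m i)" for m
    using insert.hyps by (intro prod.cong) (auto simp: r_def)
  with x have "(\<Sum>m\<in>E0. q m) \<noteq> 0"
    by (simp add: q_def)
  moreover have "coeff (\<Sum>m\<in>E. monom (q m) (m j)) (m0 j) = (\<Sum>m\<in>E0. q m)"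
    using insert.prems(1) by (simp add: coeff_sum E0_def sum.inter_filter)
  ultimately have "(\<Sum>m\<in>E. monom (q m) (m j)) \<noteq> 0"
    by (metis coeff_0)
  then obtain s where s: "poly (\<Sum>m\<in>E. monom (q m) (m j)) s \<noteq> 0"
    using poly_nonroot[OF inf] by blast
  have "(\<Prod>i\<in>S. (x(j := s)) i ^ m i) = (\<Prod>i\<in>S. x i ^ m i)" for m
    using insert.hyps by (intro prod.cong) auto
  then have "(\<Sum>m\<in>E. f m * (\<Prod>i\<in>insert j S. (x(j := s)) i ^ m i)) =
      poly (\<Sum>m\<in>E. monom (q m) (m j)) s"
    using insert.hyps by (simp add: poly_sum poly_monom q_def mult_ac)
  with s show ?case by metis
qed

section \<open>Polynomial functions of bounded degree in each variable\<close>

definition fun_scale :: "'k::field \<Rightarrow> ('x \<Rightarrow> 'k) \<Rightarrow> 'x \<Rightarrow> 'k" where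
  "fun_scale c g = (\<lambda>y. c * g y)"

interpretation fun_space: vector_space fun_scale
  by unfold_locales (auto simp: fun_scale_def algebra_simps)

definition monomial :: "('p \<Rightarrow> nat) \<Rightarrow> ('p::finite \<Rightarrow> 'k::field) \<Rightarrow> 'k" where
  "monomial m = (\<lambda>y. \<Prod>p\<in>UNIV. y p ^ m p)"

definition exponent_box :: "'p set \<Rightarrow> nat \<Rightarrow> ('p \<Rightarrow> nat) set" where
  "exponent_box P e = {m. \<forall>p. m p \<le> (if p \<in> P then e else 0)}"

lemma exponent_box_finite_card:
  fixes P :: "'p::finite set"
  shows "finite (exponent_box P e)" "card (exponent_box P e) = (e + 1) ^ card P"
proof -
  have eq: "exponent_box P e = PiE UNIV (\<lambda>p. if p \<in> P then {..e} else {0})"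
    by (auto simp: exponent_box_def PiE_def Pi_def split: if_splits)
  show "finite (exponent_box P e)"
    unfolding eq by (intro finite_PiE) auto
  have "card (exponent_box P e) = (\<Prod>p\<in>UNIV. if p \<in> P then e + 1 else 1)"
    unfolding eq by (subst card_PiE) (auto intro!: prod.cong)
  also have "\<dots> = (e + 1) ^ card P"
    by (simp add: prod.If_cases)
  finally show "card (exponent_box P e) = (e + 1) ^ card P" .
qed

definition box_polys :: "'p::finite set \<Rightarrow> nat \<Rightarrow> (('p \<Rightarrow> 'k::field) \<Rightarrow> 'k) set" where
  "box_polys P e = fun_space.span (monomial ` exponent_box P e)"

lemma box_polys_add: "g \<in> box_polys P e \<Longrightarrow> h \<in> box_polys P e \<Longrightarrow> g + h \<in> box_polys P e"
  by (simp add: box_polys_def fun_space.span_add)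

lemma box_polys_scale: "g \<in> box_polys P e \<Longrightarrow> (\<lambda>y. c * g y) \<in> box_polys P e"
  using fun_space.span_scale[of g _ c] by (simp add: box_polys_def fun_scale_def)

lemma box_polys_mono: "e \<le> e' \<Longrightarrow> g \<in> box_polys P e \<Longrightarrow> g \<in> box_polys P e'"
proof -
  assume "e \<le> e'" "g \<in> box_polys P e"
  moreover have "exponent_box P e \<subseteq> exponent_box P e'"
    using \<open>e \<le> e'\<close> by (auto simp: exponent_box_def split: if_splits intro: order_trans)
  ultimately show ?thesis
    unfolding box_polys_def by (meson fun_space.span_mono image_mono subsetD)
qed

lemma box_polys_const: "(\<lambda>y. c) \<in> box_polys P e"
proof -
  have "monomial (\<lambda>_. 0) \<in> box_polys P e"
    unfolding box_polys_def by (intro fun_space.span_base imageI) (simp add: exponent_box_def)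
  from box_polys_scale[OF this, of c] show ?thesis
    by (simp add: monomial_def)
qed

lemma box_polys_sum: "(\<And>i. i \<in> I \<Longrightarrow> g i \<in> box_polys P e) \<Longrightarrow> (\<lambda>y. \<Sum>i\<in>I. g i y) \<in> box_polys P e"
  by (induction I rule: infinite_finite_induct)
    (auto simp: box_polys_const intro: box_polys_add[unfolded plus_fun_def])

lemma box_polys_var:
  fixes p :: "'p::finite"
  assumes "p \<in> P"
  shows "(\<lambda>y. y p :: 'k::field) \<in> box_polys P 1"
proof -
  have eq: "(\<lambda>y. y p :: 'k) = monomial (\<lambda>q. if q = p then 1 else 0)"
    by (simp add: monomial_def fun_eq_iff if_distrib[of "\<lambda>n. _ ^ n"] cong: if_cong)
  show ?thesis
    unfolding eq box_polys_def using assms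
    by (intro fun_space.span_base imageI) (simp add: exponent_box_def)
qed

lemma box_polys_mult:
  assumes "g \<in> box_polys P e" "h \<in> box_polys P e'"
  shows "(\<lambda>y. g y * h y) \<in> box_polys P (e + e')"
proof -
  have sub: "fun_space.subspace {g. (\<lambda>y. g y * h y) \<in> box_polys P (e + e')}" for h
    unfolding fun_space.subspace_def using box_polys_const[of 0]
    by (auto simp: fun_scale_def distrib_right mult.assoc box_polys_scale
        intro: box_polys_add[unfolded plus_fun_def])
  have sub': "fun_space.subspace {h. (\<lambda>y. g y * h y) \<in> box_polys P (e + e')}" for g
    using sub[of g] by (simp add: mult.commute)
  have mono: "(\<lambda>y. monomial m y * h y) \<in> box_polys P (e + e')" if m: "m \<in> exponent_box P e" for m
    using assms(2) unfolding box_polys_def[of P e']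
  proof (induction rule: fun_space.span_induct)
    case base
    show ?case by (rule sub')
  next
    case (step q)
    then obtain m' where m': "q = monomial m'" "m' \<in> exponent_box P e'" by auto
    have "(\<lambda>p. m p + m' p) \<in> exponent_box P (e + e')"
      unfolding exponent_box_def
    proof (intro CollectI allI)
      fix p
      have "m p \<le> (if p \<in> P then e else 0)" "m' p \<le> (if p \<in> P then e' else 0)"
        using m m'(2) by (simp_all add: exponent_box_def)
      then show "m p + m' p \<le> (if p \<in> P then e + e' else 0)"
        by (cases "p \<in> P") auto
    qed
    moreover have "(\<lambda>y. monomial m y * q y) = monomial (\<lambda>p. m p + m' p)"
      by (simp add: m'(1) monomial_def power_add prod.distrib fun_eq_iff)
    ultimately show ?case
      unfolding box_polys_def by (auto intro: fun_space.span_base)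
  qed
  show ?thesis
    using assms(1) unfolding box_polys_def[of P e]
  proof (induction rule: fun_space.span_induct)
    case base
    show ?case by (rule sub)
  next
    case (step q)
    then show ?case using mono by blast
  qed
qed

lemma box_polys_power: "g \<in> box_polys P e \<Longrightarrow> (\<lambda>y. g y ^ n) \<in> box_polys P (e * n)"
proof (induction n)
  case (Suc n)
  then show ?case using box_polys_mult[of g P e "\<lambda>y. g y ^ n" "e * n"] by simp
qed (simp add: box_polys_const)

lemma box_polys_prod:
  "finite I \<Longrightarrow> (\<And>i. i \<in> I \<Longrightarrow> g i \<in> box_polys P e) \<Longrightarrow> (\<lambda>y. \<Prod>i\<in>I. g i y) \<in> box_polys P (e * card I)"
proof (induction rule: finite_induct)
  case (insert i I)
  then show ?case
    using box_polys_mult[of "g i" P e "\<lambda>y. \<Prod>i\<in>I. g i y" "e * card I"] by simp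
qed (simp add: box_polys_const)

text \<open>There are \<open>(M + 1) ^ card C\<close> monomials in the \<open>F i\<close> with exponents at most \<open>M\<close>, and they lie in a
  space of dimension \<open>O(M ^ card P)\<close>.\<close>

lemma algebraic_dependence:
  fixes F :: "'i::finite \<Rightarrow> ('p::finite \<Rightarrow> 'k::field) \<Rightarrow> 'k"
  assumes F: "\<And>i. i \<in> C \<Longrightarrow> F i \<in> box_polys P e" and less: "card P < card C"
  shows "\<exists>M f. (\<exists>m\<in>exponent_box C M. f m \<noteq> 0) \<and>
    (\<forall>y. (\<Sum>m\<in>exponent_box C M. f m * (\<Prod>i\<in>C. F i y ^ m i)) = 0)"
proof -
  \<comment> \<open>The products have degree at most \<open>e * M * card C \<le> R * M\<close> in
    each variable, and \<open>R * M + 1 \<le> R * (M + 1)\<close>. With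
    \<open>M = R ^ card P\<close> the dimension is at most \<open>M * (M + 1) ^ card P\<close>, just
    below the next power of \<open>M + 1\<close>.\<close>
  define R where "R = e * card C + 1"
  define M where "M = R ^ card P"
  have mem: "(\<lambda>y. \<Prod>i\<in>C. F i y ^ m i) \<in> box_polys P (R * M)" if "m \<in> exponent_box C M" for m
  proof -
    have "(\<lambda>y. F i y ^ m i) \<in> box_polys P (e * M)" if "i \<in> C" for i
    proof (rule box_polys_mono[OF _ box_polys_power[OF F[OF that]]])
      show "e * m i \<le> e * M"
        using \<open>m \<in> exponent_box C M\<close> that by (auto simp: exponent_box_def dest: spec[of _ i])
    qed
    then have "(\<lambda>y. \<Prod>i\<in>C. F i y ^ m i) \<in> box_polys P (e * M * card C)"
      by (intro box_polys_prod) auto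
    then show ?thesis
      by (rule box_polys_mono[rotated]) (simp add: R_def)
  qed
  let ?B = "monomial ` exponent_box P (R * M) :: (('p \<Rightarrow> 'k) \<Rightarrow> 'k) set"
  have finB: "finite ?B"
    by (intro finite_imageI exponent_box_finite_card)
  have "card ?B \<le> (R * M + 1) ^ card P"
    using card_image_le[OF exponent_box_finite_card(1)] by (metis exponent_box_finite_card(2))
  also have "\<dots> \<le> (R * (M + 1)) ^ card P"
    by (intro power_mono) (auto simp: R_def)
  also have "\<dots> = M * (M + 1) ^ card P"
    by (simp only: power_mult_distrib) (simp only: M_def)
  also have "\<dots> < (M + 1) ^ (card P + 1)"
    by simp
  also have "\<dots> \<le> (M + 1) ^ card C"
    using less by (intro power_increasing) auto
  finally have card_less: "card ?B < card (exponent_box C M)"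
    by (simp add: exponent_box_finite_card)
  have "\<forall>m\<in>exponent_box C M. \<exists>r. (\<lambda>y. \<Prod>i\<in>C. F i y ^ m i) = (\<Sum>b\<in>?B. fun_scale (r b) b)"
    using mem unfolding box_polys_def fun_space.span_finite[OF finB] by blast
  from bchoice[OF this] obtain r where
    r: "\<And>m. m \<in> exponent_box C M \<Longrightarrow> (\<lambda>y. \<Prod>i\<in>C. F i y ^ m i) = (\<Sum>b\<in>?B. fun_scale (r m b) b)"
    by blast
  have r': "(\<Prod>i\<in>C. F i y ^ m i) = (\<Sum>b\<in>?B. r m b * b y)" if "m \<in> exponent_box C M" for m y
  proof -
    have "(\<Sum>b\<in>B. fun_scale (r m b) b) y = (\<Sum>b\<in>B. r m b * b y)" for B
      by (induction B rule: infinite_finite_induct) (auto simp: fun_scale_def)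
    then show ?thesis
      using fun_cong[OF r[OF that], of y] by simp
  qed
  obtain f where f: "\<exists>m\<in>exponent_box C M. f m \<noteq> 0"
    "\<forall>b\<in>?B. (\<Sum>m\<in>exponent_box C M. f m * r m b) = 0"
    using homogeneous_system_nontrivial_solution[OF finB exponent_box_finite_card(1) card_less, of r]
    by blast
  have "(\<Sum>m\<in>exponent_box C M. f m * (\<Prod>i\<in>C. F i y ^ m i)) = 0" for y
  proof -
    have "(\<Sum>m\<in>exponent_box C M. f m * (\<Prod>i\<in>C. F i y ^ m i)) =
        (\<Sum>m\<in>exponent_box C M. \<Sum>b\<in>?B. f m * r m b * b y)"
      by (intro sum.cong refl) (simp only: r' sum_distrib_left mult.assoc)
    also have "\<dots> = (\<Sum>b\<in>?B. (\<Sum>m\<in>exponent_box C M. f m * r m b) * b y)"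
      by (subst sum.swap) (simp only: sum_distrib_right)
    also have "\<dots> = 0"
      using f(2) by (intro sum.neutral) simp
    finally show ?thesis .
  qed
  with f(1) show ?thesis by blast
qed

text \<open>On a cone every homogeneous component of a vanishing polynomial vanishes.\<close>

lemma homogeneous_relation:
  fixes F :: "'i::finite \<Rightarrow> ('p::finite \<Rightarrow> 'k::field) \<Rightarrow> 'k"
  assumes inf: "infinite (UNIV :: 'k set)"
    and F: "\<And>i. i \<in> C \<Longrightarrow> F i \<in> box_polys P e" and less: "card P < card C"
  shows "\<exists>d f. (\<exists>x. hom_poly_eval d f x \<noteq> 0) \<and>
    (\<forall>x x'. (\<forall>i\<in>C. x i = x' i) \<longrightarrow> hom_poly_eval d f x = hom_poly_eval d f x') \<and>
    (\<forall>x. (\<forall>c. \<exists>y. \<forall>i\<in>C. c * x i = F i y) \<longrightarrow> hom_poly_eval d f x = 0)"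
proof -
  obtain M f m0 where m0: "m0 \<in> exponent_box C M" "f m0 \<noteq> 0"
    and rel: "\<And>y. (\<Sum>m\<in>exponent_box C M. f m * (\<Prod>i\<in>C. F i y ^ m i)) = 0"
    using algebraic_dependence[where F = F, OF F less] by blast
  define d where "d = (\<Sum>i\<in>UNIV. m0 i)"
  define E where "E = {m \<in> exponent_box C M. (\<Sum>i\<in>UNIV. m i) = d}"
  define f' where "f' m = (if m \<in> exponent_box C M then f m else 0)" for m
  have supp: "m i = 0" if "m \<in> exponent_box C M" "i \<notin> C" for m i
    using that by (auto simp: exponent_box_def dest: spec[of _ i])
  have eval: "hom_poly_eval d f' x = (\<Sum>m\<in>E. f m * (\<Prod>i\<in>C. x i ^ m i))" for x
  proof -
    have "hom_poly_eval d f' x = (\<Sum>m\<in>E. f m * (\<Prod>i\<in>UNIV. x i ^ m i))"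
      unfolding hom_poly_eval_def
      by (intro sum.mono_neutral_cong_right) (auto simp: finite_exponents E_def f'_def)
    also have "\<dots> = (\<Sum>m\<in>E. f m * (\<Prod>i\<in>C. x i ^ m i))"
    proof (intro sum.cong refl arg_cong2[where f = "(*)"])
      fix m assume "m \<in> E"
      then have "m i = 0" if "i \<notin> C" for i
        using supp that by (simp add: E_def)
      then show "(\<Prod>i\<in>UNIV. x i ^ m i) = (\<Prod>i\<in>C. x i ^ m i)"
        by (intro prod.mono_neutral_right) auto
    qed
    finally show ?thesis .
  qed
  show ?thesis
  proof (intro exI[of _ d] exI[of _ f'] conjI allI impI)
    show "\<exists>x. hom_poly_eval d f' x \<noteq> 0"
      unfolding eval using m0 supp exponent_box_finite_card(1)[of C M]
      by (intro polynomial_nonzero_value[OF inf, of C E m0]) (auto simp: E_def d_def)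
  next
    fix x x' :: "'i \<Rightarrow> 'k" assume "\<forall>i\<in>C. x i = x' i"
    then show "hom_poly_eval d f' x = hom_poly_eval d f' x'"
      unfolding eval by (intro sum.cong refl arg_cong2[where f = "(*)"] prod.cong) auto
  next
    fix x assume x: "\<forall>c. \<exists>y. \<forall>i\<in>C. c * x i = F i y"
    \<comment> \<open>The relation evaluated at \<open>c * x\<close>, as a polynomial in
      \<open>c\<close>. Its coefficient at \<open>d\<close> is the component of degree
      \<open>d\<close> at \<open>x\<close>, and that component is a nonzero polynomial because it
      contains \<open>m0\<close>.\<close>
    define p where "p = (\<Sum>m\<in>exponent_box C M. monom (f m * (\<Prod>i\<in>C. x i ^ m i)) (\<Sum>i\<in>C. m i))"
    have "poly p c = 0" for c
    proof -
      obtain y where y: "\<forall>i\<in>C. c * x i = F i y" using x by blast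
      have "poly p c = (\<Sum>m\<in>exponent_box C M. f m * (\<Prod>i\<in>C. (c * x i) ^ m i))"
        by (simp add: p_def poly_sum poly_monom power_mult_distrib prod.distrib power_sum mult_ac)
      also have "\<dots> = (\<Sum>m\<in>exponent_box C M. f m * (\<Prod>i\<in>C. F i y ^ m i))"
        using y by simp
      finally show ?thesis using rel by simp
    qed
    then have "p = 0"
      using poly_nonroot[OF inf, of p] by blast
    then have "0 = coeff p d" by simp
    also have "\<dots> = (\<Sum>m\<in>{m \<in> exponent_box C M. (\<Sum>i\<in>C. m i) = d}. f m * (\<Prod>i\<in>C. x i ^ m i))"
      unfolding p_def coeff_sum using exponent_box_finite_card(1)[of C M]
      by (subst sum.inter_filter) simp_all
    also have "{m \<in> exponent_box C M. (\<Sum>i\<in>C. m i) = d} = E"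
    proof -
      have "(\<Sum>i\<in>UNIV. m i) = (\<Sum>i\<in>C. m i)" if "m \<in> exponent_box C M" for m
        using supp[OF that] by (intro sum.mono_neutral_right) auto
      then show ?thesis by (auto simp: E_def)
    qed
    finally show "hom_poly_eval d f' x = 0"
      by (simp add: eval)
  qed
qed

section \<open>Tuples of forms with an isotropic subspace\<close>

lemma card_ordered_pairs:
  fixes r :: "'n \<Rightarrow> nat"
  assumes "finite J" "inj_on r J"
  shows "2 * card {(a, b). a \<in> J \<and> b \<in> J \<and> r a < r b} + card J = card J * card J"
proof -
  let ?L = "{(a, b). a \<in> J \<and> b \<in> J \<and> r a < r b}" and ?G = "{(a, b). a \<in> J \<and> b \<in> J \<and> r b < r a}"
    and ?D = "(\<lambda>a. (a, a)) ` J"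
  have fin: "finite ?L" "finite ?G" "finite ?D"
    using assms(1) by (auto intro: finite_subset[of _ "J \<times> J"])
  have "J \<times> J = ?L \<union> ?G \<union> ?D"
    using assms(2) by (auto simp: inj_on_def)
  then have "card (J \<times> J) = card (?L \<union> ?G \<union> ?D)"
    by simp
  also have "\<dots> = card ?L + card ?G + card ?D"
    using fin by (subst card_Un_disjoint | force)+
  also have "card ?G = card ?L"
    by (rule bij_betw_same_card[of "\<lambda>(a, b). (b, a)"]) (auto simp: bij_betw_def inj_on_def image_iff)
  also have "card ?D = card J"
    by (rule card_image) (simp add: inj_on_def)
  finally have "card J * card J = card ?L + card ?L + card J"
    by (simp only: card_cartesian_product)
  moreover have "2 * l + j = q" if "q = l + l + j" for l j q :: nat
    using that by simp
  ultimately show ?thesis by blast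
qed

text \<open>Steinitz exchange instead of row reduction: \<open>k\<close> independent vectors of the
  subspace are completed to a basis by unit vectors with indices in \<open>C\<close>. Each other
  unit vector is then congruent to an element of the subspace modulo those in \<open>C\<close>, and
  \<open>J\<close> is the complement of \<open>C\<close>.\<close>

lemma subspace_chart:
  fixes U :: "('k::field ^ 'n::finite) set"
  assumes U: "vec.subspace U" and k: "k \<le> vec.dim U"
  obtains J h where "card J = k" "\<And>j. j \<in> J \<Longrightarrow> axis j 1 + (\<Sum>a\<in>-J. h a j *s axis a 1) \<in> U"
proof -
  obtain B0 where B0: "B0 \<subseteq> U" "vec.independent B0" "U \<subseteq> vec.span B0" "card B0 = vec.dim U"
    by (rule vec.basis_exists)
  obtain B where B: "B \<subseteq> B0" "card B = k" "finite B"
    using obtain_subset_with_card_n[of k B0] k B0(4) by auto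
  have indB: "vec.independent B"
    using B0(2) B(1) by (rule vec.independent_mono)
  let ?E = "range (\<lambda>i. axis i 1 :: 'k ^ 'n)"
  obtain T where T: "B \<subseteq> T" "T \<subseteq> B \<union> ?E" "vec.independent T" "B \<union> ?E \<subseteq> vec.span T"
    by (rule vec.maximal_independent_subset_extend[OF _ indB, of "B \<union> ?E"]) auto
  have "cart_basis \<subseteq> vec.span T"
    using T(4) by (auto simp: cart_basis_def)
  then have spanT: "vec.span T = UNIV"
    using vec.span_minimal[of cart_basis "vec.span T"] vec.subspace_span vec.span_Basis by auto
  then have cardT: "card T = CARD('n)"
    using vec.dim_span_eq_card_independent[OF T(3)] vec.dim_UNIV by (simp add: card_cart_basis)
  define C where "C = {i. axis i (1 :: 'k) \<in> T - B}"
  have finT: "finite T" using T(3) by (rule vec.finiteI_independent)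
  have TB: "T - B = (\<lambda>i. axis i 1) ` C"
    using T(2) by (auto simp: C_def)
  have inj: "inj (\<lambda>i. axis i 1 :: 'k ^ 'n)"
    by (auto simp: inj_on_def axis_eq_axis)
  have "card C = card (T - B)"
    unfolding TB using inj by (metis card_image inj_on_subset subset_UNIV)
  then have cardC: "card C = CARD('n) - k"
    using cardT B(2) T(1) by (simp add: card_Diff_subset[OF B(3)])
  have "k \<le> CARD('n)"
    using card_mono[OF finT T(1)] cardT B(2) by simp
  define J where "J = - C"
  have "card J = k"
    unfolding J_def Compl_eq_Diff_UNIV using cardC \<open>k \<le> CARD('n)\<close> by (subst card_Diff_subset) auto
  have "\<exists>h. axis j 1 + (\<Sum>a\<in>C. h a *s axis a 1) \<in> U" for j :: 'n
  proof -
    have "axis j 1 \<in> vec.span (B \<union> (\<lambda>i. axis i 1) ` C)"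
    proof -
      have "T = B \<union> (\<lambda>i. axis i 1) ` C" using TB T(1) by blast
      then show ?thesis using spanT by auto
    qed
    then obtain u w where uw: "axis j (1 :: 'k) = u + w" "u \<in> vec.span B" "w \<in> vec.span ((\<lambda>i. axis i 1) ` C)"
      unfolding vec.span_Un by blast
    obtain g where g: "w = (\<Sum>e\<in>(\<lambda>i. axis i 1) ` C. g e *s e)"
      using uw(3) vec.span_finite[of "(\<lambda>i. axis i 1) ` C"] by auto
    have "w = (\<Sum>a\<in>C. g (axis a 1) *s axis a 1)"
      unfolding g by (subst sum.reindex) (auto intro: inj_on_subset[OF inj])
    then have "axis j 1 + (\<Sum>a\<in>C. - g (axis a 1) *s axis a 1) = u"
      using uw(1) by (simp add: sum_negf vec.scale_minus_left)
    moreover have "u \<in> U"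
      using uw(2) B(1) B0(1) U vec.span_minimal by blast
    ultimately show ?thesis by (intro exI[of _ "\<lambda>a. - g (axis a 1)"]) simp
  qed
  then have "\<forall>j. \<exists>h. axis j 1 + (\<Sum>a\<in>C. h a *s axis a 1) \<in> U" by blast
  from choice[OF this] obtain h where "\<And>j. axis j 1 + (\<Sum>a\<in>C. h j a *s axis a 1) \<in> U" by blast
  then show ?thesis
    using that[of J "\<lambda>a j. h j a"] \<open>card J = k\<close> by (simp add: J_def)
qed

lemma alternating_form_simps:
  assumes "alternating_form \<phi>"
  shows "\<phi> (x + x') y = \<phi> x y + \<phi> x' y" "\<phi> y (x + x') = \<phi> y x + \<phi> y x'"
    "\<phi> (c *s x) y = c * \<phi> x y" "\<phi> y (c *s x) = c * \<phi> y x" "\<phi> x x = 0"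
  using assms unfolding alternating_form_def Vector_Spaces.linear_iff by simp_all

lemma alternating_form_skew:
  assumes "alternating_form \<phi>"
  shows "\<phi> x y = - \<phi> y x"
  using alternating_form_simps(5)[OF assms, of "x + y"]
  unfolding alternating_form_simps(1,2)[OF assms]
  by (simp add: alternating_form_simps(5)[OF assms] eq_neg_iff_add_eq_0 add.commute)

lemma alternating_form_sum:
  assumes "alternating_form \<phi>"
  shows "\<phi> (\<Sum>i\<in>I. f i) y = (\<Sum>i\<in>I. \<phi> (f i) y)" "\<phi> y (\<Sum>i\<in>I. f i) = (\<Sum>i\<in>I. \<phi> y (f i))"
proof -
  have "\<phi> 0 y = 0" "\<phi> y 0 = 0"
    using alternating_form_simps(3)[OF assms, of 0 0 y] alternating_form_simps(4)[OF assms, of y 0 0]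
    by simp_all
  then show "\<phi> (\<Sum>i\<in>I. f i) y = (\<Sum>i\<in>I. \<phi> (f i) y)" "\<phi> y (\<Sum>i\<in>I. f i) = (\<Sum>i\<in>I. \<phi> y (f i))"
    by (induction I rule: infinite_finite_induct) (simp_all add: alternating_form_simps[OF assms])
qed

text \<open>For a fixed set \<open>J\<close>, these are the parameters and the coordinates of a tuple of forms
  vanishing on the span of the vectors \<open>axis j 1 + (\<Sum>a\<in>-J. h a j *s axis a 1)\<close>, \<open>j \<in> J\<close>:
  \<open>Inr (a, j)\<close> stands for \<open>h a j\<close>, and \<open>Inl\<close> for the entries of the Gram matrices in the basis that
  these vectors form together with the remaining standard ones.\<close>

definition chart_params :: "('n::finite \<Rightarrow> nat) \<Rightarrow> 'n set \<Rightarrow> (('t::finite \<times> 'n \<times> 'n) + ('n \<times> 'n)) set" where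
  "chart_params r J = Inl ` (UNIV \<times> ({(a, b). r a < r b} - {(a, b). a \<in> J \<and> b \<in> J \<and> r a < r b}))
     \<union> Inr ` ((- J) \<times> J)"

text \<open>Coefficient of the adapted basis vector \<open>c\<close> in \<open>axis a 1\<close>.
  Inverting the unipotent base change only flips the sign of \<open>h\<close>, so the coefficients
  stay polynomial.\<close>

definition chart_basis :: "'n::finite set \<Rightarrow> 'n \<Rightarrow> 'n \<Rightarrow> (('t \<times> 'n \<times> 'n) + ('n \<times> 'n) \<Rightarrow> 'k::field) \<Rightarrow> 'k" where
  "chart_basis J c a = (\<lambda>y. (if c = a then 1 else 0) - (if a \<in> J \<and> c \<notin> J then y (Inr (c, a)) else 0))"

definition chart_gram :: "('n::finite \<Rightarrow> nat) \<Rightarrow> 'n set \<Rightarrow> 't \<Rightarrow> 'n \<Rightarrow> 'n \<Rightarrow>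
    (('t \<times> 'n \<times> 'n) + ('n \<times> 'n) \<Rightarrow> 'k::field) \<Rightarrow> 'k" where
  "chart_gram r J i c d = (\<lambda>y. if c \<in> J \<and> d \<in> J then 0 else if r c < r d then y (Inl (i, c, d))
     else if r d < r c then - y (Inl (i, d, c)) else 0)"

definition chart_coord :: "('n::finite \<Rightarrow> nat) \<Rightarrow> 'n set \<Rightarrow> 't \<times> 'n \<times> 'n \<Rightarrow>
    (('t \<times> 'n \<times> 'n) + ('n \<times> 'n) \<Rightarrow> 'k::field) \<Rightarrow> 'k" where
  "chart_coord r J = (\<lambda>(i, a, b) y.
     \<Sum>c\<in>UNIV. \<Sum>d\<in>UNIV. chart_basis J c a y * chart_basis J d b y * chart_gram r J i c d y)"

lemma chart_coord_box:
  fixes J :: "'n::finite set" and q :: "'t::finite \<times> 'n \<times> 'n"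
  shows "(chart_coord r J q :: _ \<Rightarrow> 'k::field) \<in> box_polys (chart_params r J) 3"
proof -
  let ?P = "chart_params r J :: (('t \<times> 'n \<times> 'n) + ('n \<times> 'n)) set"
  obtain i a b where q: "q = (i, a, b)" by (cases q)
  have basis: "(chart_basis J c a :: _ \<Rightarrow> 'k) \<in> box_polys ?P 1" for c a
  proof (cases "a \<in> J \<and> c \<notin> J")
    case True
    then have "(\<lambda>y. y (Inr (c, a)) :: 'k) \<in> box_polys ?P 1"
      by (intro box_polys_var) (auto simp: chart_params_def)
    from box_polys_add[OF box_polys_const[of "if c = a then 1 else 0"] box_polys_scale[OF this, of "- 1"]]
    show ?thesis
      using True by (simp add: chart_basis_def plus_fun_def)
  next
    case False
    then have "(chart_basis J c a :: (('t \<times> 'n \<times> 'n) + ('n \<times> 'n) \<Rightarrow> 'k) \<Rightarrow> 'k) = (\<lambda>_. if c = a then 1 else 0)"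
      by (auto simp: chart_basis_def fun_eq_iff)
    then show ?thesis
      using box_polys_const by metis
  qed
  have gram: "(chart_gram r J i c d :: _ \<Rightarrow> 'k) \<in> box_polys ?P 1" for c d
  proof -
    have var: "(\<lambda>y. y (Inl (i, c, d)) :: 'k) \<in> box_polys ?P 1" if "\<not> (c \<in> J \<and> d \<in> J)" "r c < r d" for c d
      using that by (intro box_polys_var) (auto simp: chart_params_def)
    consider "c \<in> J \<and> d \<in> J" | "\<not> (c \<in> J \<and> d \<in> J)" "r c < r d" | "\<not> (c \<in> J \<and> d \<in> J)" "r d < r c"
      | "\<not> (c \<in> J \<and> d \<in> J)" "r c = r d" by linarith
    then show ?thesis
    proof cases
      case 1
      then have "(chart_gram r J i c d :: (('t \<times> 'n \<times> 'n) + ('n \<times> 'n) \<Rightarrow> 'k) \<Rightarrow> 'k) = (\<lambda>y. 0)"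
        by (auto simp: chart_gram_def fun_eq_iff)
      then show ?thesis by (simp only: box_polys_const)
    next
      case 2
      then have "(chart_gram r J i c d :: (('t \<times> 'n \<times> 'n) + ('n \<times> 'n) \<Rightarrow> 'k) \<Rightarrow> 'k) = (\<lambda>y. y (Inl (i, c, d)))"
        by (auto simp: chart_gram_def fun_eq_iff)
      then show ?thesis using var[OF 2] by (simp only:)
    next
      case 3
      then have "(chart_gram r J i c d :: (('t \<times> 'n \<times> 'n) + ('n \<times> 'n) \<Rightarrow> 'k) \<Rightarrow> 'k) = (\<lambda>y. - 1 * y (Inl (i, d, c)))"
        by (auto simp: chart_gram_def fun_eq_iff)
      moreover have nJ: "\<not> (d \<in> J \<and> c \<in> J)" using 3 by blast
      ultimately show ?thesis
        using box_polys_scale[OF var[OF nJ 3(2)], of "- 1"] by (simp only:)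
    next
      case 4
      then have "(chart_gram r J i c d :: (('t \<times> 'n \<times> 'n) + ('n \<times> 'n) \<Rightarrow> 'k) \<Rightarrow> 'k) = (\<lambda>y. 0)"
        by (auto simp: chart_gram_def fun_eq_iff)
      then show ?thesis by (simp only: box_polys_const)
    qed
  qed
  have "(\<lambda>y. chart_basis J c a y * chart_basis J d b y * chart_gram r J i c d y :: 'k) \<in> box_polys ?P (1 + 1 + 1)"
    for c d
    by (intro box_polys_mult basis gram)
  then have "(\<lambda>y. chart_basis J c a y * chart_basis J d b y * chart_gram r J i c d y :: 'k) \<in> box_polys ?P 3"
    for c d
    by (simp add: numeral_3_eq_3)
  then show ?thesis
    unfolding chart_coord_def q prod.case by (intro box_polys_sum)
qed

text \<open>Isotropy removes \<open>t * k * (k - 1) / 2\<close> Gram entries while the position of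
  the subspace adds \<open>k * (n - k)\<close> parameters; \<open>dim\<close> says that the first
  number is larger.\<close>

lemma chart_params_card:
  fixes J :: "'n::finite set"
  assumes r: "inj r" and k: "card J = k" "k \<ge> 1" and dim: "2 * (CARD('n) - k) < CARD('t) * (k - 1)"
  shows "card (chart_params r J :: (('t::finite \<times> 'n \<times> 'n) + ('n \<times> 'n)) set)
    < card {(i :: 't, a, b). r a < r b}"
proof -
  define p where "p = card {(a, b). a \<in> J \<and> b \<in> J \<and> r a < r b}"
  define N where "N = card {(a, b). r a < r b}"
  have "p \<le> N"
    unfolding p_def N_def by (intro card_mono) auto
  have p: "2 * p + k = k * k"
    using card_ordered_pairs[of J r] r k by (simp add: p_def inj_on_subset)
  have "{(i :: 't, a, b). r a < r b} = UNIV \<times> {(a, b). r a < r b}"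
    by auto
  then have C: "card {(i :: 't, a, b). r a < r b} = CARD('t) * N"
    by (simp add: card_cartesian_product N_def)
  have "card (chart_params r J :: (('t \<times> 'n \<times> 'n) + ('n \<times> 'n)) set) =
      CARD('t) * (N - p) + (CARD('n) - k) * k"
  proof -
    have "card ({(a, b). r a < r b} - {(a, b). a \<in> J \<and> b \<in> J \<and> r a < r b}) = N - p"
      unfolding N_def p_def by (rule card_Diff_subset) auto
    moreover have "card (- J) = CARD('n) - k"
      using k(1) by (simp add: Compl_eq_Diff_UNIV card_Diff_subset)
    ultimately show ?thesis
      unfolding chart_params_def
      by (subst card_Un_disjoint) (auto simp: card_image card_cartesian_product k(1))
  qed
  moreover have "(CARD('n) - k) * k < CARD('t) * p"
  proof -
    have kp: "(k - 1) * k = 2 * p"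
      using p k(2) by (simp add: diff_mult_distrib)
    have "2 * (CARD('n) - k) * k < CARD('t) * (k - 1) * k"
      using dim k(2) by simp
    then have "2 * ((CARD('n) - k) * k) < 2 * (CARD('t) * p)"
      unfolding mult.assoc kp by (simp only: mult.left_commute)
    then show ?thesis
      by simp
  qed
  moreover have "CARD('t) * (N - p) + CARD('t) * p = CARD('t) * N"
    using \<open>p \<le> N\<close> by (simp flip: distrib_left)
  ultimately show ?thesis
    by (simp add: C)
qed

text \<open>The scalar \<open>c\<close>, possibly 0, is absorbed by the Gram parameters with
  \<open>h\<close> unchanged. This supplies the cone condition of
  \<open>homogeneous_relation\<close>.\<close>

lemma form_coord_chart:
  fixes \<Phi> :: "('k::field, 'n::finite, 't::finite) form_tuple"
  assumes alt: "\<Phi> \<in> form_tuples" and r: "inj r"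
    and iso: "\<And>i j j'. j \<in> J \<Longrightarrow> j' \<in> J \<Longrightarrow>
      \<Phi> i (axis j 1 + (\<Sum>a\<in>-J. h a j *s axis a 1)) (axis j' 1 + (\<Sum>a\<in>-J. h a j' *s axis a 1)) = 0"
  shows "\<exists>y. \<forall>q. c * form_coord \<Phi> q = chart_coord r J q y"
proof -
  define u where "u j = (if j \<in> J then axis j 1 + (\<Sum>a\<in>-J. h a j *s axis a 1) else axis j 1)" for j
  define y where "y = case_sum (\<lambda>(i, a, b). c * \<Phi> i (u a) (u b)) (\<lambda>(a, j). h a j)"
  have \<Phi>: "alternating_form (\<Phi> i)" for i
    using alt by (simp add: form_tuples_def)
  have gram: "chart_gram r J i a b y = c * \<Phi> i (u a) (u b)" for i a b
  proof -
    have "\<Phi> i (u a) (u b) = - \<Phi> i (u b) (u a)"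
      by (rule alternating_form_skew[OF \<Phi>])
    moreover have "a = b" if "r a = r b"
      using that r by (simp add: inj_def)
    ultimately show ?thesis
      using iso[of a b i] by (auto simp: chart_gram_def y_def u_def alternating_form_simps(5)[OF \<Phi>])
  qed
  have axis: "axis a 1 = (\<Sum>c\<in>UNIV. chart_basis J c a y *s u c)" for a
  proof -
    have "(\<Sum>c\<in>UNIV. chart_basis J c a y *s u c) =
        (\<Sum>c\<in>UNIV. if c = a then u c else 0) - (\<Sum>c\<in>UNIV. if c \<in> -J then if a \<in> J then h c a *s axis c 1 else 0 else 0)"
      unfolding sum_subtractf[symmetric]
      by (intro sum.cong refl) (auto simp: chart_basis_def y_def u_def vec.scale_left_diff_distrib vec.scale_minus_left)
    also have "\<dots> = u a - (\<Sum>c\<in>-J. if a \<in> J then h c a *s axis c 1 else 0)"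
      by (simp add: sum.If_cases Compl_eq)
    also have "\<dots> = axis a 1"
      by (simp add: u_def)
    finally show ?thesis ..
  qed
  have "c * form_coord \<Phi> q = chart_coord r J q y" for q
  proof -
    obtain i a b where q: "q = (i, a, b)" by (cases q)
    have left: "\<Phi> i (axis a 1) v = (\<Sum>c\<in>UNIV. chart_basis J c a y * \<Phi> i (u c) v)" for a v
      by (subst axis) (simp add: alternating_form_sum(1)[OF \<Phi>] alternating_form_simps(3)[OF \<Phi>])
    have right: "\<Phi> i v (axis a 1) = (\<Sum>c\<in>UNIV. chart_basis J c a y * \<Phi> i v (u c))" for a v
      by (subst axis) (simp add: alternating_form_sum(2)[OF \<Phi>] alternating_form_simps(4)[OF \<Phi>])
    have "form_coord \<Phi> q = \<Phi> i (axis a 1) (axis b 1)"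
      by (simp add: form_coord_def q)
    also have "\<dots> = (\<Sum>c\<in>UNIV. \<Sum>d\<in>UNIV. chart_basis J c a y * (chart_basis J d b y * \<Phi> i (u c) (u d)))"
      unfolding left[of a "axis b 1"] unfolding right[of _ b] sum_distrib_left ..
    finally show ?thesis
      by (simp add: chart_coord_def q gram sum_distrib_left mult_ac)
  qed
  then show ?thesis by blast
qed

text \<open>Projection to \<open>V\<close>: the subalgebra lies in the sum of its projection and the
  centre part \<open>S\<close>, so at most \<open>t\<close> dimensions are lost.\<close>

lemma isotropic_subspace_of_subalgebra:
  fixes \<Phi> :: "('k::field, 'n::finite, 't::finite) form_tuple"
  assumes "has_commutative_subalgebra assoc_scale (assoc_bracket \<Phi>) (k + CARD('t))"
  obtains U where "vec.subspace U" "k \<le> vec.dim U" "\<And>i x y. x \<in> U \<Longrightarrow> y \<in> U \<Longrightarrow> \<Phi> i x y = 0"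
proof -
  interpret pr: vector_space_prod "(*s) :: 'k \<Rightarrow> 'k ^ 'n \<Rightarrow> 'k ^ 'n" "(*s) :: 'k \<Rightarrow> 'k ^ 't \<Rightarrow> 'k ^ 't"
    by unfold_locales
  obtain A where A: "pr.p.subspace A" "\<And>p q. p \<in> A \<Longrightarrow> q \<in> A \<Longrightarrow> assoc_bracket \<Phi> p q = 0"
    "pr.p.dim A = k + CARD('t)"
    using assms unfolding has_commutative_subalgebra_def by blast
  define U where "U = fst ` A"
  have U: "vec.subspace U"
    unfolding vec.subspace_def U_def
  proof (intro conjI ballI allI)
    show "0 \<in> fst ` A"
      using pr.p.subspace_0[OF A(1)] by force
    show "x + y \<in> fst ` A" if "x \<in> fst ` A" "y \<in> fst ` A" for x y
      using that pr.p.subspace_add[OF A(1)] by (auto simp: image_iff) (metis fst_add fst_conv)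
    show "c *s x \<in> fst ` A" if "x \<in> fst ` A" for c x
      using that pr.p.subspace_scale[OF A(1)] by (auto simp: image_iff) (metis pr.scale_prod fst_conv)
  qed
  obtain B where B: "B \<subseteq> U" "vec.independent B" "U \<subseteq> vec.span B" "card B = vec.dim U"
    by (rule vec.basis_exists)
  have "finite B" using B(2) by (rule vec.finiteI_independent)
  define S where "S = (\<lambda>b. (b, 0 :: 'k ^ 't)) ` B \<union> (\<lambda>i. (0 :: 'k ^ 'n, axis i 1)) ` UNIV"
  have left: "(x, 0) \<in> pr.p.span S" if "x \<in> U" for x
  proof -
    have "x \<in> vec.span B" using B(3) that by blast
    then show ?thesis
    proof (induction rule: vec.span_induct)
      case base
      show ?case
        unfolding vec.subspace_def
        using pr.p.span_zero[of S] pr.p.span_add[of "(_, 0)" S "(_, 0)"] pr.p.span_scale[of "(_, 0)" S]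
        by (auto simp: zero_prod_def pr.scale_prod)
    next
      case (step b)
      then show ?case by (auto simp: S_def intro: pr.p.span_base)
    qed
  qed
  have right: "(0, y) \<in> pr.p.span S" for y
  proof -
    have "y \<in> vec.span cart_basis" using vec.span_Basis by auto
    then show ?thesis
    proof (induction rule: vec.span_induct)
      case base
      show ?case
        unfolding vec.subspace_def
        using pr.p.span_zero[of S] pr.p.span_add[of "(0, _)" S "(0, _)"] pr.p.span_scale[of "(0, _)" S]
        by (auto simp: zero_prod_def pr.scale_prod)
    next
      case (step b)
      then show ?case by (auto simp: S_def cart_basis_def intro: pr.p.span_base)
    qed
  qed
  have "A \<subseteq> pr.p.span S"
  proof
    fix p assume "p \<in> A"
    then have "fst p \<in> U" by (simp add: U_def)
    have "p = (fst p, 0) + (0, snd p)" by simp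
    then show "p \<in> pr.p.span S"
      using pr.p.span_add[OF left[OF \<open>fst p \<in> U\<close>] right[of "snd p"]] by simp
  qed
  then have "pr.p.dim A \<le> card S"
    using \<open>finite B\<close> by (intro pr.p.dim_le_card) (auto simp: S_def)
  also have "card S \<le> card B + CARD('t)"
    unfolding S_def using \<open>finite B\<close> by (intro card_Un_le[THEN order_trans] add_mono card_image_le) auto
  finally have "k \<le> vec.dim U"
    using A(3) B(4) by simp
  moreover have "\<Phi> i x y = 0" if xy: "x \<in> U" "y \<in> U" for i x y
  proof -
    obtain p q where pq: "p \<in> A" "q \<in> A" "x = fst p" "y = fst q"
      using xy by (auto simp: U_def)
    have "(\<Sum>j\<in>UNIV. \<Phi> j x y *s axis j 1) = 0"
      using A(2)[OF pq(1,2)] by (simp add: assoc_bracket_def pq zero_prod_def)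
    then have "(\<Sum>j\<in>UNIV. \<Phi> j x y *s axis j 1) $ i = 0"
      by simp
    moreover have "(\<Sum>j\<in>UNIV. \<Phi> j x y *s axis j 1) $ i = \<Phi> i x y"
      by (simp add: sum_component axis_def if_distrib cong: if_cong)
    ultimately show ?thesis by simp
  qed
  ultimately show ?thesis using that U by blast
qed

text \<open>The second clause compensates for redundant coordinates: a point where the polynomial is
  nonzero need not come from alternating forms, but it may be replaced by a tuple with the same
  entries above the diagonal.\<close>

lemma chart_polynomial:
  fixes J :: "'n::finite set"
  assumes inf: "infinite (UNIV :: 'k::field set)" and r: "inj (r :: 'n \<Rightarrow> nat)"
    and k: "card J = k" "k \<ge> 1" and dim: "2 * (CARD('n) - k) < CARD('t::finite) * (k - 1)"
  shows "\<exists>d f. (\<exists>x. hom_poly_eval d f x \<noteq> 0) \<and>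
    (\<forall>x x'. (\<forall>i a b. r a < r b \<longrightarrow> x (i, a, b) = x' (i, a, b)) \<longrightarrow> hom_poly_eval d f x = hom_poly_eval d f x') \<and>
    (\<forall>(\<Phi> :: ('k, 'n, 't) form_tuple) h. \<Phi> \<in> form_tuples \<longrightarrow> (\<forall>i. \<forall>j\<in>J. \<forall>j'\<in>J.
      \<Phi> i (axis j 1 + (\<Sum>a\<in>-J. h a j *s axis a 1)) (axis j' 1 + (\<Sum>a\<in>-J. h a j' *s axis a 1)) = 0)
      \<longrightarrow> hom_poly_eval d f (form_coord \<Phi>) = 0)"
proof -
  have "\<exists>d f. (\<exists>x. hom_poly_eval d f x \<noteq> 0) \<and>
    (\<forall>x x'. (\<forall>q\<in>{(i :: 't, a, b). r a < r b}. x q = x' q) \<longrightarrow> hom_poly_eval d f x = hom_poly_eval d f x') \<and>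
    (\<forall>x. (\<forall>c. \<exists>y. \<forall>q\<in>{(i, a, b). r a < r b}. c * x q = (chart_coord r J q y :: 'k)) \<longrightarrow> hom_poly_eval d f x = 0)"
    by (rule homogeneous_relation[OF inf chart_coord_box chart_params_card[OF r k dim]])
  then obtain d f where
    nz: "\<exists>x. hom_poly_eval d f x \<noteq> (0 :: 'k)" and
    dep: "\<And>x x'. \<forall>q\<in>{(i :: 't, a, b). r a < r b}. x q = x' q \<Longrightarrow> hom_poly_eval d f x = hom_poly_eval d f x'" and
    zero: "\<And>x. \<forall>c. \<exists>y. \<forall>q\<in>{(i, a, b). r a < r b}. c * x q = chart_coord r J q y \<Longrightarrow> hom_poly_eval d f x = 0"
    by blast
  show ?thesis
  proof (intro exI[of _ d] exI[of _ f] conjI allI impI)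
    show "hom_poly_eval d f x = hom_poly_eval d f x'" if "\<forall>i a b. r a < r b \<longrightarrow> x (i, a, b) = x' (i, a, b)" for x x'
      using that by (intro dep) auto
    fix \<Phi> :: "('k, 'n, 't) form_tuple" and h
    assume \<Phi>: "\<Phi> \<in> form_tuples" and iso: "\<forall>i. \<forall>j\<in>J. \<forall>j'\<in>J.
      \<Phi> i (axis j 1 + (\<Sum>a\<in>-J. h a j *s axis a 1)) (axis j' 1 + (\<Sum>a\<in>-J. h a j' *s axis a 1)) = 0"
    have "\<exists>y. \<forall>q. c * form_coord \<Phi> q = chart_coord r J q y" for c
      by (rule form_coord_chart[OF \<Phi> r, where h = h]) (use iso in blast)
    then show "hom_poly_eval d f (form_coord \<Phi>) = 0"
      by (intro zero) blast
  qed (rule nz)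
qed

section \<open>Genericity: a proper closed set containing all exceptional points\<close>

lemma form_tuple_of_coords:
  fixes x :: "'t::finite \<times> 'n::finite \<times> 'n \<Rightarrow> 'k::field" and r :: "'n \<Rightarrow> nat"
  obtains \<Phi> where "\<Phi> \<in> form_tuples" "\<And>i a b. r a < r b \<Longrightarrow> form_coord \<Phi> (i, a, b) = x (i, a, b)"
proof -
  define \<Phi> where "\<Phi> i u v = (\<Sum>a\<in>UNIV. \<Sum>b\<in>UNIV. if r a < r b then x (i, a, b) * (u $ a * v $ b - u $ b * v $ a) else 0)"
    for i and u v :: "'k ^ 'n"
  have add: "\<Phi> i (u + u') v = \<Phi> i u v + \<Phi> i u' v" "\<Phi> i v (u + u') = \<Phi> i v u + \<Phi> i v u'" for i u u' v
    unfolding \<Phi>_def sum.distrib[symmetric] by (intro sum.cong refl; simp add: algebra_simps)+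
  have scale: "\<Phi> i (c *s u) v = c * \<Phi> i u v" "\<Phi> i v (c *s u) = c * \<Phi> i v u" for i c u v
    unfolding \<Phi>_def sum_distrib_left by (intro sum.cong refl; simp add: algebra_simps)+
  have self: "\<Phi> i u u = 0" for i u
    unfolding \<Phi>_def by (intro sum.neutral ballI) (simp add: mult.commute)
  have "\<Phi> \<in> form_tuples"
    unfolding form_tuples_def alternating_form_def Vector_Spaces.linear_iff
    using add scale self vec.vector_space_axioms vector_space_over_itself.vector_space_axioms by blast
  moreover have "form_coord \<Phi> (i, a, b) = x (i, a, b)" if "r a < r b" for i a b
  proof -
    have "form_coord \<Phi> (i, a, b) = (\<Sum>a'\<in>UNIV. \<Sum>b'\<in>UNIV. if b' = b then if a' = a then x (i, a, b) else 0 else 0)"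
      unfolding form_coord_def \<Phi>_def prod.case
      using that by (intro sum.cong refl) (auto simp: axis_def)
    then show ?thesis by simp
  qed
  ultimately show ?thesis by (rule that)
qed

lemma lin_indep_tuple_if_minor:
  fixes \<Phi> :: "('k::field, 'n::finite, 't::finite) form_tuple"
  assumes "det (\<chi> l l'. form_coord \<Phi> (l', c l)) \<noteq> 0"
  shows "lin_indep_tuple \<Phi>"
  unfolding lin_indep_tuple_def
proof (intro allI impI)
  fix g i assume g: "\<forall>x y. (\<Sum>i\<in>UNIV. g i * \<Phi> i x y) = 0"
  define A where "A = (\<chi> l l'. form_coord \<Phi> (l', c l))"
  have "A *v (\<chi> i. g i) = 0"
  proof (subst vec_eq_iff, intro allI)
    fix l
    obtain a b where "c l = (a, b)" by (cases "c l")
    then have "(A *v (\<chi> i. g i)) $ l = (\<Sum>i\<in>UNIV. g i * \<Phi> i (axis a 1) (axis b 1))"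
      by (simp add: A_def matrix_vector_mult_def form_coord_def mult.commute)
    with g show "(A *v (\<chi> i. g i)) $ l = 0 $ l" by simp
  qed
  moreover have "invertible A"
    using assms by (simp add: invertible_det_nz A_def)
  ultimately have "(\<chi> i. g i) = 0"
    using matrix_left_invertible_ker[of A] unfolding invertible_def by blast
  then show "g i = 0"
    by (simp add: vec_eq_iff)
qed

text \<open>The closed set is the union, over the finitely many charts \<open>J\<close>, of the zero
  sets of the chart polynomials. It is proper because some tuple makes all these polynomials and a
  maximal minor nonzero at once; the minor places that tuple in \<open>param_space\<close>.\<close>

lemma generic_no_commutative_subalgebra:
  assumes inf: "infinite (UNIV :: 'k::field set)" and k: "k \<ge> 1"
    and dim: "2 * (CARD('n::finite) - k) < CARD('t::finite) * (k - 1)"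
    and t: "CARD('t) \<le> CARD('n) * (CARD('n) - 1) div 2"
  shows "generic (\<lambda>(smul :: 'k \<Rightarrow> ('k ^ 'n) \<times> ('k ^ 't) \<Rightarrow> ('k ^ 'n) \<times> ('k ^ 't)) bracket.
    \<not> has_commutative_subalgebra smul bracket (k + CARD('t)))"
proof -
  obtain r :: "'n \<Rightarrow> nat" where r: "inj r"
    using finite_imp_inj_to_nat_seg[of "UNIV :: 'n set"] by auto
  let ?\<J> = "{J :: 'n set. card J = k}"
  have "\<forall>J\<in>?\<J>. \<exists>df. (\<exists>x. hom_poly_eval (fst df) (snd df) x \<noteq> (0 :: 'k)) \<and>
    (\<forall>x x' :: 't \<times> 'n \<times> 'n \<Rightarrow> 'k. (\<forall>i a b. r a < r b \<longrightarrow> x (i, a, b) = x' (i, a, b)) \<longrightarrow>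
      hom_poly_eval (fst df) (snd df) x = hom_poly_eval (fst df) (snd df) x') \<and>
    (\<forall>(\<Phi> :: ('k, 'n, 't) form_tuple) h. \<Phi> \<in> form_tuples \<longrightarrow> (\<forall>i. \<forall>j\<in>J. \<forall>j'\<in>J.
      \<Phi> i (axis j 1 + (\<Sum>a\<in>-J. h a j *s axis a 1)) (axis j' 1 + (\<Sum>a\<in>-J. h a j' *s axis a 1)) = 0)
      \<longrightarrow> hom_poly_eval (fst df) (snd df) (form_coord \<Phi>) = 0)"
  proof
    fix J assume "J \<in> ?\<J>"
    then have "card J = k" by simp
    from chart_polynomial[OF inf r this k dim] show "\<exists>df. (\<exists>x. hom_poly_eval (fst df) (snd df) x \<noteq> (0 :: 'k)) \<and>
    (\<forall>x x' :: 't \<times> 'n \<times> 'n \<Rightarrow> 'k. (\<forall>i a b. r a < r b \<longrightarrow> x (i, a, b) = x' (i, a, b)) \<longrightarrow>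
      hom_poly_eval (fst df) (snd df) x = hom_poly_eval (fst df) (snd df) x') \<and>
    (\<forall>(\<Phi> :: ('k, 'n, 't) form_tuple) h. \<Phi> \<in> form_tuples \<longrightarrow> (\<forall>i. \<forall>j\<in>J. \<forall>j'\<in>J.
      \<Phi> i (axis j 1 + (\<Sum>a\<in>-J. h a j *s axis a 1)) (axis j' 1 + (\<Sum>a\<in>-J. h a j' *s axis a 1)) = 0)
      \<longrightarrow> hom_poly_eval (fst df) (snd df) (form_coord \<Phi>) = 0)"
      unfolding split_paired_Ex fst_conv snd_conv .
  qed
  from bchoice[OF this] obtain df where df: "\<And>J. card J = k \<Longrightarrow>
    (\<exists>x. hom_poly_eval (fst (df J)) (snd (df J)) x \<noteq> (0 :: 'k)) \<and>
    (\<forall>x x' :: 't \<times> 'n \<times> 'n \<Rightarrow> 'k. (\<forall>i a b. r a < r b \<longrightarrow> x (i, a, b) = x' (i, a, b)) \<longrightarrow>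
      hom_poly_eval (fst (df J)) (snd (df J)) x = hom_poly_eval (fst (df J)) (snd (df J)) x') \<and>
    (\<forall>(\<Phi> :: ('k, 'n, 't) form_tuple) h. \<Phi> \<in> form_tuples \<longrightarrow> (\<forall>i. \<forall>j\<in>J. \<forall>j'\<in>J.
      \<Phi> i (axis j 1 + (\<Sum>a\<in>-J. h a j *s axis a 1)) (axis j' 1 + (\<Sum>a\<in>-J. h a j' *s axis a 1)) = 0)
      \<longrightarrow> hom_poly_eval (fst (df J)) (snd (df J)) (form_coord \<Phi>) = 0)"
    by auto
  define ev where "ev J = hom_poly_eval (fst (df J)) (snd (df J))" for J
  have ev_nz: "\<exists>x. ev J x \<noteq> 0" and
    ev_dep: "\<forall>i a b. r a < r b \<longrightarrow> x (i, a, b) = x' (i, a, b) \<Longrightarrow> ev J x = ev J x'" and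
    ev_zero: "\<Phi> \<in> form_tuples \<Longrightarrow> \<forall>i. \<forall>j\<in>J. \<forall>j'\<in>J.
      \<Phi> i (axis j 1 + (\<Sum>a\<in>-J. h a j *s axis a 1)) (axis j' 1 + (\<Sum>a\<in>-J. h a j' *s axis a 1)) = 0 \<Longrightarrow>
      ev J (form_coord \<Phi>) = 0" if "card J = k" for J x x' \<Phi> h
    using df[OF that] unfolding ev_def by blast+
  define W :: "('k, 'n, 't) form_tuple set set" where "W = (\<Union>J\<in>?\<J>. proj_zeros {df J})"
  have W: "closedin zariski W"
    unfolding W_def by (intro closedin_Union) (auto simp: closedin_zariski)
  have in_W: "p \<in> W \<longleftrightarrow> (\<exists>J. card J = k \<and> ev J (form_coord \<Phi>) = 0)"
    if "p = proj_point \<Phi>" "p \<in> proj_space" for p \<Phi>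
    using that by (auto simp: W_def ev_def proj_point_in_zeros_iff case_prod_unfold)
  have param_sub: "param_space \<subseteq> (proj_space :: ('k, 'n, 't) form_tuple set set)"
  proof -
    have "\<not> lin_indep_tuple (\<lambda>i x y. 0 :: 'k :: field)"
      unfolding lin_indep_tuple_def by (auto intro: exI[of _ "\<lambda>_. 1"])
    then show ?thesis
      by (auto simp: param_space_def proj_space_def)
  qed
  have "W \<inter> param_space \<noteq> param_space"
  proof -
    have "2 * card {(a, b). r a < r b} + CARD('n) = CARD('n) * CARD('n)"
      using card_ordered_pairs[of UNIV r] r by simp
    then have "card {(a, b). r a < r b} = CARD('n) * (CARD('n) - 1) div 2"
      by (simp add: diff_mult_distrib2)
    \<comment> \<open>The bound \<open>t\<close> on the number of pairs enters here: distinct pairs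
      \<open>c l\<close> select the columns of a \<open>t\<close> by \<open>t\<close> minor whose
      entries all lie above the diagonal.\<close>
    then obtain c :: "'t \<Rightarrow> 'n \<times> 'n" where c: "range c \<subseteq> {(a, b). r a < r b}" "inj c"
      using card_le_inj[of "UNIV :: 't set" "{(a, b). r a < r b}"] t by auto
    define D where "D x = det (\<chi> l l'. (x (l', c l) :: 'k))" for x :: "'t \<times> 'n \<times> 'n \<Rightarrow> 'k"
    have "\<exists>x. \<forall>g\<in>insert D (ev ` ?\<J>). g x \<noteq> 0"
    proof (rule common_nonzero[OF inf])
      show "line_poly g" if "g \<in> insert D (ev ` ?\<J>)" for g
        using that line_poly_det[of "\<lambda>l l'. (l', c l)"] by (auto simp: D_def[abs_def] ev_def line_poly_hom_poly_eval)
      have "D (\<lambda>(l, q). if c l = q then 1 else 0) = det (mat 1 :: 'k ^ 't ^ 't)"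
        unfolding D_def mat_def using c(2)
        by (intro arg_cong[where f = det]) (auto simp: vec_eq_iff inj_def)
      then have "\<exists>x. D x \<noteq> 0"
        by (intro exI[of _ "\<lambda>(l, q). if c l = q then 1 else 0"]) (simp add: det_I)
      then show "\<exists>x. g x \<noteq> 0" if "g \<in> insert D (ev ` ?\<J>)" for g
        using that ev_nz by auto
    qed simp
    then obtain x where x: "D x \<noteq> 0" "\<And>J. card J = k \<Longrightarrow> ev J x \<noteq> 0" by auto
    obtain \<Phi> :: "('k, 'n, 't) form_tuple" where
      \<Phi>: "\<Phi> \<in> form_tuples" "\<And>i a b. r a < r b \<Longrightarrow> form_coord \<Phi> (i, a, b) = x (i, a, b)"
      using form_tuple_of_coords[of r x] by blast
    have "form_coord \<Phi> (l', c l) = x (l', c l)" for l l'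
      using c(1) \<Phi>(2)[of "fst (c l)" "snd (c l)"] by (auto simp: subset_iff)
    then have "lin_indep_tuple \<Phi>"
      using x(1) by (intro lin_indep_tuple_if_minor[of \<Phi> c]) (simp add: D_def)
    then have "proj_point \<Phi> \<in> param_space"
      using \<Phi>(1) by (auto simp: param_space_def)
    moreover have "ev J (form_coord \<Phi>) \<noteq> 0" if "card J = k" for J
      using ev_dep[OF that, of "form_coord \<Phi>" x] x(2)[OF that] \<Phi>(2) by simp
    ultimately show ?thesis
      using in_W[OF refl, of \<Phi>] param_sub by blast
  qed
  moreover have "p \<in> W"
    if p: "p \<in> param_space" and \<Psi>: "\<Psi> \<in> p"
      and sub: "has_commutative_subalgebra assoc_scale (assoc_bracket \<Psi>) (k + CARD('t))"
    for p :: "('k, 'n, 't) form_tuple set" and \<Psi>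
  proof -
    obtain \<Phi> where \<Phi>: "p = proj_point \<Phi>" "\<Phi> \<in> form_tuples"
      using p by (auto simp: param_space_def)
    obtain s where s: "s \<noteq> 0" "\<Psi> = (\<lambda>i x y. s * \<Phi> i x y)"
      using \<Psi> unfolding \<Phi>(1) proj_point_def by blast
    obtain U where U: "vec.subspace U" "k \<le> vec.dim U" "\<And>i x y. x \<in> U \<Longrightarrow> y \<in> U \<Longrightarrow> \<Psi> i x y = 0"
      using isotropic_subspace_of_subalgebra[OF sub] by blast
    obtain J h where J: "card J = k" "\<And>j. j \<in> J \<Longrightarrow> axis j 1 + (\<Sum>a\<in>-J. h a j *s axis a 1) \<in> U"
      using subspace_chart[OF U(1,2)] by blast
    have "ev J (form_coord \<Phi>) = 0"
      using U(3) J(2) s by (intro ev_zero[OF J(1) \<Phi>(2), of h]) simp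
    then show ?thesis
      using in_W[OF \<Phi>(1)] p param_sub J(1) by blast
  qed
  ultimately show ?thesis
    unfolding generic_def using W
    by (intro exI[of _ "W \<inter> param_space"]) (auto simp: closedin_subtopology)
qed

theorem theorem2:
  fixes n t s :: nat
  assumes "1 \<le> t" and "t \<le> n * (n - 1) div 2"
    and "s = (2 * n + t\<^sup>2 + 3 * t) div (t + 2)"
  shows
    "(t > 1 \<longrightarrow>
        (\<forall>(smul :: 'k::alg_closed_field \<Rightarrow> 'l::ab_group_add \<Rightarrow> 'l) bracket.
           nilp2_class smul bracket n t \<longrightarrow> has_commutative_subalgebra smul bracket s)) \<and>
     (infinite (UNIV :: 'f::field set) \<and> CARD('n::finite) = n \<and> CARD('t::finite) = t \<longrightarrow>
        generic (\<lambda>(smul :: 'f \<Rightarrow> ('f ^ 'n) \<times> ('f ^ 't) \<Rightarrow> ('f ^ 'n) \<times> ('f ^ 't)) bracket.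
           \<not> has_commutative_subalgebra smul bracket (s + 1)))"
proof -
  define k where "k = (2 * n + t) div (t + 2)"
  have "2 * n + t\<^sup>2 + 3 * t = (2 * n + t) + t * (t + 2)"
    by (simp add: power2_eq_square algebra_simps)
  then have s: "s = k + t"
    unfolding assms(3) k_def by (simp only: div_mult_self1)
  have "n \<ge> 1"
    using assms(1,2) by (cases n) auto
  then have k1: "k \<ge> 1"
    unfolding k_def by (simp add: div_greater_zero_iff Suc_le_eq)
  have "k * (t + 2) \<le> 2 * n + t"
    unfolding k_def by (rule div_times_less_eq_dividend)
  moreover obtain k' where k': "k = Suc k'" using k1 by (cases k) auto
  ultimately have le: "t * k' + 2 * k \<le> 2 * n"
    by (simp add: algebra_simps)
  have "2 * n + t < (k + 1) * (t + 2)"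
    unfolding k_def by (metis add.commute add_gr_0 dividend_less_times_div mult.commute zero_less_numeral Suc_eq_plus1 mult_Suc)
  then have less: "2 * n < t * k + 2 * (k + 1)"
    by (simp add: algebra_simps)
  show ?thesis
  proof (intro conjI impI allI)
    fix smul :: "'k \<Rightarrow> 'l \<Rightarrow> 'l" and bracket
    assume "t > 1" "nilp2_class smul bracket n t"
    then show "has_commutative_subalgebra smul bracket s"
      unfolding s using le k' by (intro commutative_subalgebra_exists) auto
  next
    assume *: "infinite (UNIV :: 'f set) \<and> CARD('n) = n \<and> CARD('t) = t"
    have "2 * (CARD('n) - (k + 1)) < CARD('t) * (k + 1 - 1)"
    \<comment> \<open>If \<open>k + 1\<close> exceeds \<open>n\<close>, truncated subtraction makes
      the left side 0, while the right side is \<open>t * k > 0\<close>.\<close>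
    proof (cases "k + 1 \<le> n")
      case True
      then show ?thesis using * less by (simp add: diff_mult_distrib2)
    next
      case False
      then show ?thesis using * k1 assms(1) by simp
    qed
    then have "generic (\<lambda>(smul :: 'f \<Rightarrow> ('f ^ 'n) \<times> ('f ^ 't) \<Rightarrow> ('f ^ 'n) \<times> ('f ^ 't)) bracket.
        \<not> has_commutative_subalgebra smul bracket (k + 1 + CARD('t)))"
      using * assms(2) by (intro generic_no_commutative_subalgebra) auto
    then show "generic (\<lambda>(smul :: 'f \<Rightarrow> ('f ^ 'n) \<times> ('f ^ 't) \<Rightarrow> ('f ^ 'n) \<times> ('f ^ 't)) bracket.
        \<not> has_commutative_subalgebra smul bracket (s + 1))"
      using * by (simp add: s add.assoc add.commute)
  qed
qed

end
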